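(* Let $N\in\{2,3,4\}$, let $\Omega\subset\mathbb{R}^N$ be open, bounded and connected with Lipschitz boundary $\Gamma$, and let $\underline{a},\overline{a},\underline{c},\overline{c}$ be positive real numbers with $\underline{a}\le\overline{a}$ and $\underline{c}\le\overline{c}$. Let $p_M>2$ be a real number, depending only on $\Omega,\underline{a},\overline{a},\underline{c},\overline{c}$, with the property that for every $(a,c)\in D(F)$, every $r\in(2,p_M)$ and every $g\in W^{1-(1/r'),r'}(\Gamma)'$ with $r':=r/(r-1)$, the unique solution $u\in H^1(\Omega)$ of $$-\nabla\cdot(a\nabla u)+cu=0\ \text{ in }\Omega,\qquad a\frac{\partial u}{\partial\nu}=g\ \text{ on }\Gamma\qquad( * )$$ belongs to $W^{1,r}(\Omega)$ (such a $p_M$ exists). Let $p\in(2,p_M)$ and $q:=p/(p-1)$. Then for any $g\in W^{1-(1/q),q}(\Gamma)'$ the parameter-to-solution operator $$G=G_g: D(F)\subset L^1(\Omega)\times L^1(\Omega)\to H^1(\Omega),\qquad (a,c)\mapsto u,$$ where $u$ is the unique solution of $( * )$, is continuous when $D(F)$ carries the $[L^1(\Omega)]^2$ topology and $H^1(\Omega)$ its norm topology. As a consequence, for any $g\in W^{1-(1/q),q}(\Gamma)'$, the forward map $$F=F_g: D(F)\subset L^1(\Omega)\times L^1(\Omega)\to H^{1/2}(\Gamma),\qquad (a,c)\mapsto u|_\Gamma,$$ is also continuous in the $[L^1(\Omega)]^2$ topology.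
   Context: $D(F)$ is the set of pairs $(a,c)$ of $L^1(\Omega)$ functions satisfying $0<\underline{a}\le a(x)\le\overline{a}$ and $0<\underline{c}\le c(x)\le\overline{c}$ for a.e. $x\in\Omega$. The space $[L^1(\Omega)]^2=L^1(\Omega)\times L^1(\Omega)$ has the product topology, generated by the norm $\|a\|_{L^1}+\|c\|_{L^1}$. Here $\nu$ is the outer-pointing normal vector on $\Gamma$. A solution of the boundary value problem is understood in the weak sense: $u\in H^1(\Omega)$ and $$\int_\Omega a\nabla u\cdot\nabla\varphi\,dx+\int_\Omega cu\varphi\,dx=\int_\Gamma g\varphi\,d\sigma\qquad\text{for all }\varphi\in H^1(\Omega),$$ where $\int_\Gamma g\varphi\,d\sigma$ denotes the duality pairing of $g\in H^{-1/2}(\Gamma)=H^{1/2}(\Gamma)'$ with the trace of $\varphi$. For each $(a,c)\in D(F)$ and $g\in H^{-1/2}(\Gamma)$ there is a unique such $u$. The restriction $u|_\Gamma$ is the trace $\gamma_0 u$, where $\gamma_0:H^1(\Omega)\to H^{1/2}(\Gamma)$ is the (linear, continuous) trace operator. The space $W^{1-(1/q),q}(\Gamma)'$ is the dual of the fractional Sobolev space $W^{1-(1/q),q}(\Gamma)$ (the trace space of $W^{1,q}(\Omega)$); since $q<2$, one has $W^{1-(1/q),q}(\Gamma)'\subset H^{-1/2}(\Gamma)$ (by restriction of functionals to $H^{1/2}(\Gamma)$). *)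

theory Defs
  imports "HOL-Analysis.Analysis"
begin

text \<open>
  Elements of Lebesgue and Sobolev spaces are represented by functions, without passing to
  equivalence classes modulo null sets. Accordingly the norms below are seminorms on these sets
  of functions, and the topologies are the pseudometric ones; passing to the Kolmogorov quotient
  identifies functions that agree almost everywhere.
\<close>

text \<open>
  The library's \<open>Metric_space\<close> locale requires distance \<open>0\<close> to imply equality of functions, so the
  topology is defined directly. On a subset \<open>S\<close> it is the subspace topology.
\<close>

definition pseudometric_topology :: "'a set \<Rightarrow> ('a \<Rightarrow> 'a \<Rightarrow> real) \<Rightarrow> 'a topology" where
  "pseudometric_topology S d =
     topology (\<lambda>U. U \<subseteq> S \<and> (\<forall>x\<in>U. \<exists>e>0. \<forall>y\<in>S. d x y < e \<longrightarrow> y \<in> U))"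

lemma openin_pseudometric_topology:
  "openin (pseudometric_topology S d) U \<longleftrightarrow>
     U \<subseteq> S \<and> (\<forall>x\<in>U. \<exists>e>0. \<forall>y\<in>S. d x y < e \<longrightarrow> y \<in> U)"
proof -
  have "istopology (\<lambda>U. U \<subseteq> S \<and> (\<forall>x\<in>U. \<exists>e>0. \<forall>y\<in>S. d x y < e \<longrightarrow> y \<in> U))"
    unfolding istopology_def
  proof (intro conjI allI impI; (elim conjE)?)
    fix U V
    assume *: "U \<subseteq> S" "V \<subseteq> S"
      "\<forall>x\<in>U. \<exists>e>0. \<forall>y\<in>S. d x y < e \<longrightarrow> y \<in> U"
      "\<forall>x\<in>V. \<exists>e>0. \<forall>y\<in>S. d x y < e \<longrightarrow> y \<in> V"
    show "U \<inter> V \<subseteq> S" using * by blast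
    show "\<forall>x\<in>U \<inter> V. \<exists>e>0. \<forall>y\<in>S. d x y < e \<longrightarrow> y \<in> U \<inter> V"
    proof
      fix x assume "x \<in> U \<inter> V"
      then obtain e1 e2 where "e1 > 0" "\<forall>y\<in>S. d x y < e1 \<longrightarrow> y \<in> U"
        "e2 > 0" "\<forall>y\<in>S. d x y < e2 \<longrightarrow> y \<in> V"
        using *(3,4) by blast
      then show "\<exists>e>0. \<forall>y\<in>S. d x y < e \<longrightarrow> y \<in> U \<inter> V"
        by (intro exI[of _ "min e1 e2"]) auto
    qed
  next
    fix \<K>
    assume *: "\<forall>K\<in>\<K>. K \<subseteq> S \<and> (\<forall>x\<in>K. \<exists>e>0. \<forall>y\<in>S. d x y < e \<longrightarrow> y \<in> K)"
    then show "\<Union>\<K> \<subseteq> S" by blast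
    show "\<forall>x\<in>\<Union>\<K>. \<exists>e>0. \<forall>y\<in>S. d x y < e \<longrightarrow> y \<in> \<Union>\<K>"
    proof
      fix x assume "x \<in> \<Union>\<K>"
      then obtain K where K: "K \<in> \<K>" "x \<in> K" by blast
      then obtain e where "e > 0" "\<forall>y\<in>S. d x y < e \<longrightarrow> y \<in> K" using * by blast
      then show "\<exists>e>0. \<forall>y\<in>S. d x y < e \<longrightarrow> y \<in> \<Union>\<K>" using K by blast
    qed
  qed
  then show ?thesis
    unfolding pseudometric_topology_def by (simp add: topology_inverse')
qed

lemma topspace_pseudometric_topology [simp]: "topspace (pseudometric_topology S d) = S"
proof -
  have "openin (pseudometric_topology S d) S"
    by (auto simp: openin_pseudometric_topology intro: exI[of _ 1])
  then show ?thesis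
    by (metis openin_pseudometric_topology openin_subset openin_topspace subset_antisym)
qed

text \<open>
  Near each boundary point, after a rotation taking the unit vector \<open>e\<close> to the last coordinate
  direction, \<open>\<Omega>\<close> is the strict epigraph of a Lipschitz function. The function \<open>h\<close> is
  evaluated only on the hyperplane orthogonal to \<open>e\<close>.
\<close>

definition lipschitz_boundary :: "'a::euclidean_space set \<Rightarrow> bool" where
  "lipschitz_boundary \<Omega> \<longleftrightarrow>
     (\<forall>x\<in>frontier \<Omega>. \<exists>r>0. \<exists>e h L. norm e = 1 \<and> lipschitz_on L {z. z \<bullet> e = 0} (h :: 'a \<Rightarrow> real) \<and>
        \<Omega> \<inter> ball x r = {y. h (y - (y \<bullet> e) *\<^sub>R e) < y \<bullet> e} \<inter> ball x r)"

definition Lp :: "real \<Rightarrow> 'a measure \<Rightarrow> ('a \<Rightarrow> 'b::euclidean_space) set" where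
  "Lp p M = {f \<in> borel_measurable M. integrable M (\<lambda>x. norm (f x) powr p)}"

primrec Ck :: "nat \<Rightarrow> ('a::euclidean_space \<Rightarrow> real) \<Rightarrow> bool" where
  "Ck 0 f \<longleftrightarrow> continuous_on UNIV f"
| "Ck (Suc k) f \<longleftrightarrow> (\<forall>x. f differentiable (at x)) \<and>
     (\<forall>b\<in>Basis. Ck k (\<lambda>x. frechet_derivative f (at x) b))"

definition C_infinity :: "('a::euclidean_space \<Rightarrow> real) set" where
  "C_infinity = {f. \<forall>k. Ck k f}"

definition test_functions :: "'a::euclidean_space set \<Rightarrow> ('a \<Rightarrow> real) set" where
  "test_functions \<Omega> = {\<phi> \<in> C_infinity. \<exists>K. compact K \<and> K \<subseteq> \<Omega> \<and> (\<forall>x. x \<notin> K \<longrightarrow> \<phi> x = 0)}"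

definition locally_integrable :: "'a::euclidean_space set \<Rightarrow> ('a \<Rightarrow> 'b::euclidean_space) \<Rightarrow> bool" where
  "locally_integrable \<Omega> f \<longleftrightarrow> f \<in> borel_measurable (lebesgue_on \<Omega>) \<and>
     (\<forall>K. compact K \<and> K \<subseteq> \<Omega> \<longrightarrow> integrable (lebesgue_on K) f)"

definition has_weak_gradient ::
  "'a::euclidean_space set \<Rightarrow> ('a \<Rightarrow> real) \<Rightarrow> ('a \<Rightarrow> 'a) \<Rightarrow> bool" where
  "has_weak_gradient \<Omega> u V \<longleftrightarrow> locally_integrable \<Omega> u \<and> locally_integrable \<Omega> V \<and>
     (\<forall>\<phi>\<in>test_functions \<Omega>. \<forall>b\<in>Basis.
        (\<integral>x. u x * frechet_derivative \<phi> (at x) b \<partial>lebesgue_on \<Omega>) =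
        - (\<integral>x. (V x \<bullet> b) * \<phi> x \<partial>lebesgue_on \<Omega>))"

definition weak_gradient :: "'a::euclidean_space set \<Rightarrow> ('a \<Rightarrow> real) \<Rightarrow> 'a \<Rightarrow> 'a" where
  "weak_gradient \<Omega> u = (SOME V. has_weak_gradient \<Omega> u V)"

definition W1 :: "real \<Rightarrow> 'a::euclidean_space set \<Rightarrow> ('a \<Rightarrow> real) set" where
  "W1 p \<Omega> = {u \<in> Lp p (lebesgue_on \<Omega>). \<exists>V\<in>Lp p (lebesgue_on \<Omega>). has_weak_gradient \<Omega> u V}"

abbreviation H1 :: "'a::euclidean_space set \<Rightarrow> ('a \<Rightarrow> real) set" where
  "H1 \<equiv> W1 2"

definition H1_norm :: "'a::euclidean_space set \<Rightarrow> ('a \<Rightarrow> real) \<Rightarrow> real" where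
  "H1_norm \<Omega> u = sqrt ((\<integral>x. (u x)\<^sup>2 \<partial>lebesgue_on \<Omega>) +
                       (\<integral>x. (norm (weak_gradient \<Omega> u x))\<^sup>2 \<partial>lebesgue_on \<Omega>))"

definition H1_topology :: "'a::euclidean_space set \<Rightarrow> ('a \<Rightarrow> real) topology" where
  "H1_topology \<Omega> = pseudometric_topology (H1 \<Omega>) (\<lambda>u v. H1_norm \<Omega> (\<lambda>x. u x - v x))"

text \<open>
  The surface measure is the Hausdorff measure of dimension \<open>s = DIM('a) - 1\<close>, normalised so that
  it agrees with Lebesgue measure on \<open>s\<close>-dimensional subspaces. Covering sets are required to be
  bounded because \<^const>\<open>diameter\<close> is only meaningful for bounded sets.
\<close>

definition hausdorff_outer :: "nat \<Rightarrow> 'a::euclidean_space set \<Rightarrow> ennreal" where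
  "hausdorff_outer s A =
     (SUP \<delta>\<in>{0<..}. INF C\<in>{C :: nat \<Rightarrow> 'a set. A \<subseteq> (\<Union>i. C i) \<and>
         (\<forall>i. bounded (C i) \<and> diameter (C i) \<le> \<delta>)}.
       \<Sum>i. ennreal (unit_ball_vol (real s) * (diameter (C i) / 2) ^ s))"

definition surface_measure :: "'a::euclidean_space set \<Rightarrow> 'a measure" where
  "surface_measure \<Gamma> =
     restrict_space (measure_of UNIV (sets borel) (hausdorff_outer (DIM('a) - 1))) \<Gamma>"

text \<open>
  The Sobolev--Slobodeckij space \<open>W\<^sup>s\<^sup>,\<^sup>q(\<Gamma>)\<close>, \<open>0 < s < 1\<close>. The exponent of the kernel is
  \<open>dim \<Gamma> + s q\<close>.
\<close>

definition slobodeckij ::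
  "real \<Rightarrow> real \<Rightarrow> 'a::euclidean_space set \<Rightarrow> ('a \<Rightarrow> real) \<Rightarrow> ennreal" where
  "slobodeckij s q \<Gamma> f =
     (\<integral>\<^sup>+x. (\<integral>\<^sup>+y. ennreal (\<bar>f x - f y\<bar> powr q / dist x y powr (real (DIM('a) - 1) + s * q))
        \<partial>surface_measure \<Gamma>) \<partial>surface_measure \<Gamma>)"

definition Wfrac :: "real \<Rightarrow> real \<Rightarrow> 'a::euclidean_space set \<Rightarrow> ('a \<Rightarrow> real) set" where
  "Wfrac s q \<Gamma> = {f \<in> Lp q (surface_measure \<Gamma>). slobodeckij s q \<Gamma> f < \<infinity>}"

definition Wfrac_norm ::
  "real \<Rightarrow> real \<Rightarrow> 'a::euclidean_space set \<Rightarrow> ('a \<Rightarrow> real) \<Rightarrow> real" where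
  "Wfrac_norm s q \<Gamma> f =
     ((\<integral>x. \<bar>f x\<bar> powr q \<partial>surface_measure \<Gamma>) + enn2real (slobodeckij s q \<Gamma> f)) powr (1 / q)"

abbreviation Hhalf :: "'a::euclidean_space set \<Rightarrow> ('a \<Rightarrow> real) set" where
  "Hhalf \<equiv> Wfrac (1/2) 2"

abbreviation Hhalf_norm :: "'a::euclidean_space set \<Rightarrow> ('a \<Rightarrow> real) \<Rightarrow> real" where
  "Hhalf_norm \<equiv> Wfrac_norm (1/2) 2"

definition Hhalf_topology :: "'a::euclidean_space set \<Rightarrow> ('a \<Rightarrow> real) topology" where
  "Hhalf_topology \<Gamma> = pseudometric_topology (Hhalf \<Gamma>) (\<lambda>f h. Hhalf_norm \<Gamma> (\<lambda>x. f x - h x))"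

text \<open>
  The dual space. Bounded functionals automatically respect equality almost everywhere, since
  functions vanishing almost everywhere have norm \<open>0\<close>.
\<close>

definition Wfrac_dual ::
  "real \<Rightarrow> real \<Rightarrow> 'a::euclidean_space set \<Rightarrow> (('a \<Rightarrow> real) \<Rightarrow> real) set" where
  "Wfrac_dual s q \<Gamma> = {g.
     (\<forall>f\<in>Wfrac s q \<Gamma>. \<forall>h\<in>Wfrac s q \<Gamma>. \<forall>\<alpha> \<beta>.
        g (\<lambda>x. \<alpha> * f x + \<beta> * h x) = \<alpha> * g f + \<beta> * g h) \<and>
     (\<exists>C. \<forall>f\<in>Wfrac s q \<Gamma>. \<bar>g f\<bar> \<le> C * Wfrac_norm s q \<Gamma> f)}"

text \<open>
  The trace operator is the continuous linear extension to \<open>H\<^sup>1(\<Omega>)\<close> of the restriction to the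
  boundary, which is prescribed on restrictions to \<open>\<Omega>\<close> of smooth functions on the whole space.
  These are dense in \<open>H\<^sup>1(\<Omega>)\<close> when \<open>\<Omega>\<close> is bounded with Lipschitz boundary, so the conditions
  below determine \<open>\<gamma> u\<close> up to equality almost everywhere on \<open>\<Gamma>\<close>.
\<close>

definition trace_operator ::
  "'a::euclidean_space set \<Rightarrow> (('a \<Rightarrow> real) \<Rightarrow> ('a \<Rightarrow> real)) \<Rightarrow> bool" where
  "trace_operator \<Omega> \<gamma> \<longleftrightarrow>
     (\<forall>u\<in>H1 \<Omega>. \<gamma> u \<in> Hhalf (frontier \<Omega>)) \<and>
     (\<forall>u\<in>H1 \<Omega>. \<forall>v\<in>H1 \<Omega>. \<forall>\<alpha> \<beta>. AE x in surface_measure (frontier \<Omega>).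
        \<gamma> (\<lambda>y. \<alpha> * u y + \<beta> * v y) x = \<alpha> * \<gamma> u x + \<beta> * \<gamma> v x) \<and>
     (\<exists>C. \<forall>u\<in>H1 \<Omega>. Hhalf_norm (frontier \<Omega>) (\<gamma> u) \<le> C * H1_norm \<Omega> u) \<and>
     (\<forall>\<phi>\<in>C_infinity. AE x in surface_measure (frontier \<Omega>). \<gamma> \<phi> x = \<phi> x)"

definition admissible ::
  "'a::euclidean_space set \<Rightarrow> real \<Rightarrow> real \<Rightarrow> real \<Rightarrow> real \<Rightarrow> (('a \<Rightarrow> real) \<times> ('a \<Rightarrow> real)) set" where
  "admissible \<Omega> al au cl cu = {(a, c).
     integrable (lebesgue_on \<Omega>) a \<and> integrable (lebesgue_on \<Omega>) c \<and>
     (AE x in lebesgue_on \<Omega>. al \<le> a x \<and> a x \<le> au) \<and>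
     (AE x in lebesgue_on \<Omega>. cl \<le> c x \<and> c x \<le> cu)}"

definition L1_norm :: "'a::euclidean_space set \<Rightarrow> ('a \<Rightarrow> real) \<Rightarrow> real" where
  "L1_norm \<Omega> f = (\<integral>x. \<bar>f x\<bar> \<partial>lebesgue_on \<Omega>)"

definition admissible_topology ::
  "'a::euclidean_space set \<Rightarrow> real \<Rightarrow> real \<Rightarrow> real \<Rightarrow> real \<Rightarrow> (('a \<Rightarrow> real) \<times> ('a \<Rightarrow> real)) topology"
where
  "admissible_topology \<Omega> al au cl cu = pseudometric_topology (admissible \<Omega> al au cl cu)
     (\<lambda>(a, c) (a', c'). L1_norm \<Omega> (\<lambda>x. a x - a' x) + L1_norm \<Omega> (\<lambda>x. c x - c' x))"

text \<open>
  In the weak formulation \<open>\<gamma>\<close> is the trace operator and \<open>g\<close> a functional on a space of functions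
  on \<open>\<Gamma>\<close> that contains \<open>H\<^sup>1\<^sup>/\<^sup>2(\<Gamma>)\<close>, so the duality pairing is application of \<open>g\<close>.
\<close>

definition weak_solution ::
  "'a::euclidean_space set \<Rightarrow> (('a \<Rightarrow> real) \<Rightarrow> ('a \<Rightarrow> real)) \<Rightarrow> ('a \<Rightarrow> real) \<Rightarrow> ('a \<Rightarrow> real) \<Rightarrow>
     (('a \<Rightarrow> real) \<Rightarrow> real) \<Rightarrow> ('a \<Rightarrow> real) \<Rightarrow> bool" where
  "weak_solution \<Omega> \<gamma> a c g u \<longleftrightarrow> u \<in> H1 \<Omega> \<and>
     (\<forall>\<phi>\<in>H1 \<Omega>.
        (\<integral>x. a x * (weak_gradient \<Omega> u x \<bullet> weak_gradient \<Omega> \<phi> x) \<partial>lebesgue_on \<Omega>) +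
        (\<integral>x. c x * u x * \<phi> x \<partial>lebesgue_on \<Omega>) = g (\<gamma> \<phi>))"

end

(*
  For two parameter pairs (a,c), (a',c') with solutions u, u', testing both weak formulations with
  u - u' and using coercivity gives
    min(al,cl)^2 * |u - u'|_{H^1}^2 <= int (a - a')^2 |grad u|^2 + int (c - c')^2 u^2.
  The point (a,c) is fixed, so |grad u|^2 and u^2 are fixed integrable weights, while the
  coefficient differences are uniformly bounded. L^1-smallness of the differences therefore makes
  the right-hand side small. Continuity of F follows by composing with the trace operator.

  As weak_gradient is a choice, linearity of the gradient rests on uniqueness of weak gradients:
  smooth bump functions approximate indicators of boxes, and Lebesgue differentiation applies.
*)
theory Submission
  imports Defs
begin

section \<open>Smooth bump functions\<close>

text \<open>The shape of the estimate comes from the splitting a grad u - a' grad u' = (a - a') grad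
  u + a' grad(u - u'), and likewise for c. Tested with u - u', the last term is coercive, while the
  first contains only the solution at the fixed point; Young's inequality absorbs half of the
  coercive term, and clearing denominators produces the factor \<open>(min al cl)^2\<close>. The
  obstacle is that |grad u|^2 is merely integrable and may be unbounded, so L^1-smallness of a - a'
  does not bound the weighted integral directly. The weight is cut at a height n. This height, and
  with it the radius \<open>\<delta>\<close>, depends on u, so the argument yields continuity at
  each point and no common modulus. Smoothness of a test function means \<open>Ck k\<close> for
  every k, a condition on iterated partial derivatives. The bumps are therefore built from
  exp(-1/t), whose derivatives stay in an explicit class indexed by polynomials.\<close>

lemma Ck_SucD: "Ck (Suc k) f \<Longrightarrow> Ck k f"
proof (induction k arbitrary: f)
  case 0
  then show ?case
    by (auto simp: continuous_on_eq_continuous_at intro: differentiable_imp_continuous_within)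
qed auto

lemma Ck_scale: "Ck k f \<Longrightarrow> Ck k (\<lambda>x. c * f x)"
proof (induction k arbitrary: f)
  case (Suc k)
  have "((\<lambda>x. c * f x) has_derivative (\<lambda>h. c * frechet_derivative f (at x) h)) (at x)" for x
    using Suc.prems by (auto intro!: has_derivative_mult_right simp: frechet_derivative_works[symmetric])
  then have "frechet_derivative (\<lambda>x. c * f x) (at x) = (\<lambda>h. c * frechet_derivative f (at x) h)" for x
    by (rule frechet_derivative_at[symmetric])
  with Suc show ?case by (auto intro: differentiable_cmult_left_iff[THEN iffD2])
qed (auto intro: continuous_intros)

lemma Ck_add: "Ck k f \<Longrightarrow> Ck k g \<Longrightarrow> Ck k (\<lambda>x. f x + g x)"
proof (induction k arbitrary: f g)
  case (Suc k)
  then have "frechet_derivative (\<lambda>x. f x + g x) (at x) =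
      (\<lambda>h. frechet_derivative f (at x) h + frechet_derivative g (at x) h)" for x
    by (intro frechet_derivative_at[symmetric] has_derivative_add) (auto simp: frechet_derivative_works[symmetric])
  with Suc show ?case by auto
qed (auto intro: continuous_intros)

lemma Ck_mult: "Ck k f \<Longrightarrow> Ck k g \<Longrightarrow> Ck k (\<lambda>x. f x * g x)"
proof (induction k arbitrary: f g)
  case (Suc k)
  then have "frechet_derivative (\<lambda>x. f x * g x) (at x) =
      (\<lambda>h. f x * frechet_derivative g (at x) h + frechet_derivative f (at x) h * g x)" for x
    by (intro frechet_derivative_at[symmetric] has_derivative_mult) (auto simp: frechet_derivative_works[symmetric])
  with Suc show ?case
    \<comment> \<open>The product rule leaves \<open>f\<close> and \<open>g\<close> themselves next
      to the partial derivatives, so their order has to be lowered to k before the induction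
      hypothesis applies.\<close>
    using Ck_SucD[of k f] Ck_SucD[of k g] by (auto intro!: Ck_add)
qed (auto intro: continuous_intros)

lemma Ck_const: "Ck k (\<lambda>x. c)"
  by (induction k arbitrary: c) (auto simp: frechet_derivative_const)

lemma Ck_prod: "(\<And>i. i \<in> I \<Longrightarrow> Ck k (f i)) \<Longrightarrow> Ck k (\<lambda>x. \<Prod>i\<in>I. f i x)"
  by (induction I rule: infinite_finite_induct) (auto intro: Ck_const Ck_mult)

text \<open>Every derivative of \<open>exp (- 1 / t)\<close>, extended by \<open>0\<close> to \<open>t \<le> 0\<close>, has this form.\<close>

definition flat :: "real poly \<Rightarrow> real \<Rightarrow> real" where
  "flat P t = (if t > 0 then poly P (1 / t) * exp (- (1 / t)) else 0)"

lemma poly_times_exp_neg_tendsto_0: "((\<lambda>y::real. poly P y * exp (- y)) \<longlongrightarrow> 0) at_top"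
proof -
  have "((\<lambda>y::real. \<Sum>i\<le>degree P. coeff P i * (y ^ i / exp y)) \<longlongrightarrow> (\<Sum>i\<le>degree P. coeff P i * 0)) at_top"
    by (intro tendsto_intros tendsto_power_div_exp_0)
  then show ?thesis
    by (simp add: poly_altdef sum_distrib_right exp_minus divide_inverse mult.assoc)
qed

text \<open>Substituting y = 1/t turns this into the decay of a polynomial times exp(-y) at
  infinity. It carries both the continuity and the differentiability of \<open>flat P\<close> at
  0.\<close>

lemma flat_tendsto_0: "(flat P \<longlongrightarrow> 0) (at_right 0)"
proof -
  have "((\<lambda>t::real. poly P (inverse t) * exp (- inverse t)) \<longlongrightarrow> 0) (at_right 0)"
    by (rule filterlim_compose[OF poly_times_exp_neg_tendsto_0 filterlim_inverse_at_top_right])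
  moreover have "eventually (\<lambda>t. poly P (inverse t) * exp (- inverse t) = flat P t) (at_right (0::real))"
    by (rule eventually_mono[OF eventually_at_right_less]) (simp add: flat_def inverse_eq_divide)
  ultimately show ?thesis by (rule Lim_transform_eventually)
qed

text \<open>With s = 1/t one has ds/dt = -s^2, so P(s) exp(-s) has derivative s^2 (P(s) - P'(s))
  exp(-s); \<open>[:0, 0, 1:]\<close> is the polynomial s^2. The family \<open>flat\<close> is thus
  closed under differentiation.\<close>

lemma DERIV_flat: "(flat P has_real_derivative flat ([:0, 0, 1:] * (P - pderiv P)) t) (at t)"
proof (cases t "0::real" rule: linorder_cases)
  case less
  have "((\<lambda>t. 0) has_real_derivative flat ([:0, 0, 1:] * (P - pderiv P)) t) (at t)"
    using less by (simp add: flat_def)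
  then show ?thesis
    by (rule has_field_derivative_transform_within_open[of _ _ _ "{..<0}"]) (use less in \<open>auto simp: flat_def\<close>)
next
  case greater
  have "((\<lambda>t. 1 / t) has_real_derivative - (1 / t ^ 2)) (at t)"
    using greater by (auto intro!: derivative_eq_intros simp: power2_eq_square)
  then have "((\<lambda>t. poly P (1 / t) * exp (- (1 / t))) has_real_derivative
      poly (pderiv P) (1 / t) * - (1 / t ^ 2) * exp (- (1 / t)) +
      exp (- (1 / t)) * - (- (1 / t ^ 2)) * poly P (1 / t)) (at t)"
    by (intro DERIV_mult DERIV_chain2[OF poly_DERIV] DERIV_chain2[OF DERIV_exp] DERIV_minus)
  also have "poly (pderiv P) (1 / t) * - (1 / t ^ 2) * exp (- (1 / t)) +
      exp (- (1 / t)) * - (- (1 / t ^ 2)) * poly P (1 / t) = flat ([:0, 0, 1:] * (P - pderiv P)) t"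
    using greater by (simp add: flat_def field_simps power2_eq_square)
  finally show ?thesis
    by (rule has_field_derivative_transform_within_open[of _ _ _ "{0<..}"]) (use greater in \<open>auto simp: flat_def\<close>)
next
  case equal
  have "((\<lambda>h. (flat P (0 + h) - flat P 0) / h) \<longlongrightarrow> 0) (at 0)"
  proof (rule filterlim_split_at)
    have "eventually (\<lambda>h. 0 = (flat P (0 + h) - flat P 0) / h) (at_left 0)"
      by (rule eventually_mono[OF eventually_at_leftI[of "-1" 0 "\<lambda>h. h < 0"]]) (auto simp: flat_def)
    then show "((\<lambda>h. (flat P (0 + h) - flat P 0) / h) \<longlongrightarrow> 0) (at_left 0)"
      by (rule Lim_transform_eventually[OF tendsto_const])
    \<comment> \<open>Dividing by h multiplies the polynomial in 1/h by its variable, so the right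
      difference quotient is again a member of the family and tends to 0.\<close>
    have "eventually (\<lambda>h. flat ([:0,1:] * P) h = (flat P (0 + h) - flat P 0) / h) (at_right 0)"
      by (rule eventually_mono[OF eventually_at_right_less[of 0]]) (auto simp: flat_def)
    then show "((\<lambda>h. (flat P (0 + h) - flat P 0) / h) \<longlongrightarrow> 0) (at_right 0)"
      by (rule Lim_transform_eventually[OF flat_tendsto_0])
  qed
  then show ?thesis using equal by (simp add: DERIV_def flat_def)
qed

text \<open>Induction on k with P arbitrary: each partial derivative is a constant times a function
  of the same form with another polynomial.\<close>

lemma Ck_flat: "Ck k (\<lambda>x. flat P (x \<bullet> e + c))"
proof (induction k arbitrary: P)
  case 0
  have "continuous_on UNIV (flat P)"
    using DERIV_flat by (auto intro!: DERIV_isCont continuous_at_imp_continuous_on)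
  then show ?case
    by (auto intro!: continuous_on_compose2[of UNIV "flat P"] continuous_on_add continuous_on_inner
        continuous_on_id continuous_on_const)
next
  case (Suc k)
  have *: "((\<lambda>x. flat P (x \<bullet> e + c)) has_derivative
      (\<lambda>h. (h \<bullet> e) * flat ([:0, 0, 1:] * (P - pderiv P)) (x \<bullet> e + c))) (at x)" for x
  proof -
    have "((\<lambda>x. x \<bullet> e + c) has_derivative (\<lambda>h. h \<bullet> e)) (at x)"
      by (auto intro!: derivative_eq_intros)
    then show ?thesis
      using has_derivative_compose[OF _ DERIV_flat[THEN has_field_derivative_imp_has_derivative], of _ "\<lambda>h. h \<bullet> e"]
      by (simp add: mult.commute)
  qed
  have "frechet_derivative (\<lambda>x. flat P (x \<bullet> e + c)) (at x) =
      (\<lambda>h. (h \<bullet> e) * flat ([:0, 0, 1:] * (P - pderiv P)) (x \<bullet> e + c))" for x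
    by (rule frechet_derivative_at[OF *, symmetric])
  moreover have "(\<lambda>x. flat P (x \<bullet> e + c)) differentiable (at x)" for x
    using * unfolding differentiable_def by blast
  moreover have "Ck k (\<lambda>x. (b \<bullet> e) * flat ([:0, 0, 1:] * (P - pderiv P)) (x \<bullet> e + c))" for b
    by (intro Ck_scale Suc)
  ultimately show ?case by (simp del: mult_pCons_left)
qed

section \<open>Smooth approximation of the indicator of a box\<close>

text \<open>\<open>flat 1 t\<close> is exp(-1/t) for t > 0. For every n > 0 the function is positive
  exactly on \<open>box a b\<close>; n does not move the support but pushes each factor exp(-1/(n
  t)) up to 1.\<close>

definition box_bump :: "'a::euclidean_space \<Rightarrow> 'a \<Rightarrow> real \<Rightarrow> 'a \<Rightarrow> real" where
  "box_bump a b n x = (\<Prod>i\<in>Basis. flat 1 (n * (x \<bullet> i - a \<bullet> i)) * flat 1 (n * (b \<bullet> i - x \<bullet> i)))"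

lemma box_bump_C_infinity: "box_bump a b n \<in> C_infinity"
proof -
  have "Ck k (\<lambda>x. flat 1 (n * (x \<bullet> i - a \<bullet> i)))" "Ck k (\<lambda>x. flat 1 (n * (b \<bullet> i - x \<bullet> i)))" for k i
    using Ck_flat[of k 1 "n *\<^sub>R i" "- n * (a \<bullet> i)"] Ck_flat[of k 1 "- n *\<^sub>R i" "n * (b \<bullet> i)"]
    by (simp_all add: algebra_simps)
  then show ?thesis
    unfolding C_infinity_def box_bump_def[abs_def] by (intro CollectI allI Ck_prod Ck_mult)
qed

lemma flat_one_bounds: "0 \<le> flat 1 t" "flat 1 t \<le> 1"
  by (auto simp: flat_def)

lemma box_bump_bounds: "0 \<le> box_bump a b n x" "box_bump a b n x \<le> 1"
proof -
  have "0 \<le> flat 1 s * flat 1 t \<and> flat 1 s * flat 1 t \<le> 1" for s t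
    using flat_one_bounds by (simp add: mult_le_one)
  then show "0 \<le> box_bump a b n x" "box_bump a b n x \<le> 1"
    unfolding box_bump_def by (simp_all add: prod_nonneg prod_le_1)
qed

text \<open>Off the open box some factor has a nonpositive argument. The value n = 0 is covered
  because \<open>flat 1 0 = 0\<close>, so the sequence over \<open>real n\<close> may start at
  0.\<close>

lemma box_bump_eq_0:
  assumes "n \<ge> 0" "x \<notin> box a b"
  shows "box_bump a b n x = 0"
proof -
  obtain i where i: "i \<in> Basis" "x \<bullet> i - a \<bullet> i \<le> 0 \<or> b \<bullet> i - x \<bullet> i \<le> 0"
    using assms(2) by (auto simp: mem_box not_less)
  then have "n * (x \<bullet> i - a \<bullet> i) \<le> 0 \<or> n * (b \<bullet> i - x \<bullet> i) \<le> 0"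
    using assms(1) by (auto intro: mult_nonneg_nonpos)
  then have "flat 1 (n * (x \<bullet> i - a \<bullet> i)) * flat 1 (n * (b \<bullet> i - x \<bullet> i)) = 0"
    unfolding flat_def by (elim disjE) simp_all
  with i(1) show ?thesis
    unfolding box_bump_def by (intro prod_zero bexI[of _ i]) simp_all
qed

lemma box_bump_test_function:
  assumes "n \<ge> 0" "cbox a b \<subseteq> \<Omega>"
  shows "box_bump a b n \<in> test_functions \<Omega>"
proof -
  have "box_bump a b n x = 0" if "x \<notin> cbox a b" for x
    using box_bump_eq_0[OF assms(1)] subsetD[OF box_subset_cbox[of a b]] that by metis
  then show ?thesis
    unfolding test_functions_def using box_bump_C_infinity assms(2)
    by (intro CollectI conjI exI[of _ "cbox a b"]) simp_all
qed

lemma box_bump_tendsto: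
  "(\<lambda>n. box_bump a b (real n) x) \<longlonglongrightarrow> indicator (box a b) x"
proof (cases "x \<in> box a b")
  case True
  have *: "(\<lambda>n. flat 1 (real n * t)) \<longlonglongrightarrow> 1" if "t > 0" for t
  proof -
    have "(\<lambda>n. exp (- (1 / t * inverse (real n)))) \<longlonglongrightarrow> exp (- (1 / t * 0))"
      by (rule tendsto_exp[OF tendsto_minus[OF tendsto_mult_left[OF lim_inverse_n]]])
    \<comment> \<open>At n = 0 the two sides are 1 and 0, hence an equality that holds only
      eventually.\<close>
    moreover have "exp (- (1 / t * inverse (real n))) = flat 1 (real n * t)" if "n \<ge> 1" for n
      using that \<open>t > 0\<close> by (simp add: flat_def inverse_eq_divide mult.commute)
    then have "eventually (\<lambda>n. exp (- (1 / t * inverse (real n))) = flat 1 (real n * t)) sequentially"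
      by (rule eventually_sequentiallyI)
    ultimately have "(\<lambda>n. flat 1 (real n * t)) \<longlonglongrightarrow> exp (- (1 / t * 0))"
      by (rule Lim_transform_eventually)
    then show ?thesis by simp
  qed
  have "(\<lambda>n. flat 1 (real n * (x \<bullet> i - a \<bullet> i)) * flat 1 (real n * (b \<bullet> i - x \<bullet> i)))
      \<longlonglongrightarrow> 1 * 1" if "i \<in> Basis" for i
    using True that by (intro tendsto_mult[OF * *]) (simp_all add: mem_box)
  then have "(\<lambda>n. box_bump a b (real n) x) \<longlonglongrightarrow> (\<Prod>i\<in>(Basis::'a set). 1 * 1)"
    unfolding box_bump_def by (rule tendsto_prod)
  then show ?thesis using True by simp
next
  case False
  then have "box_bump a b (real n) x = 0" for n by (intro box_bump_eq_0) simp_all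
  then show ?thesis using False by simp
qed

section \<open>Weak gradients\<close>

text \<open>One compact set serves both the function and its partial derivative: the complement of K
  is open, so \<open>\<phi>\<close> vanishes in a neighbourhood of each point outside K.\<close>

lemma test_functionE:
  assumes "\<phi> \<in> test_functions \<Omega>" "b \<in> Basis"
  obtains K where "compact K" "K \<subseteq> \<Omega>"
    "\<forall>x. x \<notin> K \<longrightarrow> \<phi> x = 0" "\<forall>x. x \<notin> K \<longrightarrow> frechet_derivative \<phi> (at x) b = 0"
    "continuous_on UNIV \<phi>" "continuous_on UNIV (\<lambda>x. frechet_derivative \<phi> (at x) b)"
proof -
  obtain K where K: "compact K" "K \<subseteq> \<Omega>" "\<And>x. x \<notin> K \<Longrightarrow> \<phi> x = 0"
    using assms(1) unfolding test_functions_def by blast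
  have "Ck k \<phi>" for k
    using assms(1) by (simp add: test_functions_def C_infinity_def)
  from this[of 0] this[of "Suc 0"] have "continuous_on UNIV \<phi>"
    "continuous_on UNIV (\<lambda>x. frechet_derivative \<phi> (at x) b)"
    using assms(2) by simp_all
  moreover have "frechet_derivative \<phi> (at x) b = 0" if "x \<notin> K" for x
  proof -
    have "(\<phi> has_derivative (\<lambda>h. 0)) (at x)"
      by (rule has_derivative_transform_within_open[OF has_derivative_const[of 0], of "- K"])
         (use K that in \<open>auto simp: open_Compl compact_imp_closed\<close>)
    from frechet_derivative_at[OF this] show ?thesis by metis
  qed
  ultimately show ?thesis using K by (intro that[of K] allI impI)
qed

text \<open>A continuous factor is bounded on the compact set K, so the product is dominated by a
  multiple of f on K, where f is integrable.\<close>

lemma integrable_compact_support_scaleR: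
  fixes f :: "'a::euclidean_space \<Rightarrow> 'b::euclidean_space" and \<psi> :: "'a \<Rightarrow> real"
  assumes \<Omega>: "open \<Omega>" and f: "locally_integrable \<Omega> f"
    and K: "compact K" "K \<subseteq> \<Omega>" "\<And>x. x \<notin> K \<Longrightarrow> \<psi> x = 0" and \<psi>: "continuous_on UNIV \<psi>"
  shows "integrable (lebesgue_on \<Omega>) (\<lambda>x. \<psi> x *\<^sub>R f x)"
proof -
  have sets: "\<Omega> \<in> sets lebesgue" "K \<in> sets lebesgue"
    using \<Omega> K(1) by (auto intro: lmeasurable_compact fmeasurableD)
  have int: "integrable lebesgue (\<lambda>x. indicator K x *\<^sub>R f x)"
  proof -
    have "integrable (lebesgue_on K) f" using f K by (simp add: locally_integrable_def)
    then show ?thesis using sets by (simp add: integrable_restrict_space)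
  qed
  obtain B where B: "\<And>x. x \<in> K \<Longrightarrow> \<bar>\<psi> x\<bar> \<le> B"
    using compact_imp_bounded[OF compact_continuous_image[OF continuous_on_subset[OF \<psi> subset_UNIV] K(1)]]
    by (auto simp: bounded_iff)
  have "\<psi> \<in> borel_measurable lebesgue"
    using borel_measurable_continuous_onI[OF \<psi>] by (simp add: measurable_completion)
  then have meas: "(\<lambda>x. \<psi> x *\<^sub>R (indicator K x *\<^sub>R f x)) \<in> borel_measurable lebesgue"
    by (rule borel_measurable_scaleR[OF _ borel_measurable_integrable[OF int]])
  have "integrable lebesgue (\<lambda>x. \<psi> x *\<^sub>R (indicator K x *\<^sub>R f x))"
  proof (rule Bochner_Integration.integrable_bound[OF integrable_scaleR_right[OF int] meas])
    have "norm (\<psi> x *\<^sub>R indicat_real K x *\<^sub>R f x) \<le> norm (B *\<^sub>R indicat_real K x *\<^sub>R f x)" for x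
      using B[of x] by (auto simp: indicator_def mult_right_mono)
    then show "AE x in lebesgue. norm (\<psi> x *\<^sub>R indicat_real K x *\<^sub>R f x) \<le> norm (B *\<^sub>R indicat_real K x *\<^sub>R f x)"
      by simp
  qed
  moreover have "(\<lambda>x. indicat_real \<Omega> x *\<^sub>R \<psi> x *\<^sub>R f x) = (\<lambda>x. \<psi> x *\<^sub>R (indicat_real K x *\<^sub>R f x))"
    using K by (auto simp: indicator_def fun_eq_iff)
  ultimately show ?thesis
    using sets by (simp add: integrable_restrict_space)
qed

section \<open>Fundamental lemma of the calculus of variations\<close>

text \<open>The indicator of a box is not a test function, but it is the pointwise limit of the
  bumps, and dominated convergence carries the hypothesis \<open>zero\<close> over to it. Passing
  from \<open>box a b\<close> to \<open>cbox a b\<close> adds a null set.\<close>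

lemma box_integral_eq_0:
  fixes f :: "'a::euclidean_space \<Rightarrow> real"
  assumes \<Omega>: "open \<Omega>" and f: "locally_integrable \<Omega> f"
    and zero: "\<And>\<phi>. \<phi> \<in> test_functions \<Omega> \<Longrightarrow> (\<integral>x. f x * \<phi> x \<partial>lebesgue_on \<Omega>) = 0"
    and sub: "cbox a b \<subseteq> \<Omega>"
  shows "f integrable_on cbox a b" "integral (cbox a b) f = 0"
proof -
  have sets: "\<Omega> \<in> sets lebesgue" using \<Omega> by auto
  have int: "integrable lebesgue (\<lambda>x. indicator (cbox a b) x *\<^sub>R f x)"
  proof -
    have "integrable (lebesgue_on (cbox a b)) f"
      using f sub compact_cbox by (simp add: locally_integrable_def)
    then show ?thesis by (simp add: integrable_restrict_space)
  qed
  then have cb: "set_integrable lebesgue (cbox a b) f"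
    by (simp add: set_integrable_def)
  then show "f integrable_on cbox a b"
    by (rule set_lebesgue_integral_eq_integral)
  have b: "set_integrable lebesgue (box a b) f"
    by (rule set_integrable_subset[OF cb]) (auto simp: box_subset_cbox)
  have m: "(\<lambda>x. indicat_real \<Omega> x * f x) \<in> borel_measurable lebesgue"
    using f sets by (simp add: locally_integrable_def borel_measurable_restrict_space_iff)
  have bm: "box_bump a b r \<in> borel_measurable lebesgue" for r
  proof -
    have "Ck 0 (box_bump a b r)" using box_bump_C_infinity unfolding C_infinity_def by blast
    then have "box_bump a b r \<in> borel_measurable borel"
      by (simp add: borel_measurable_continuous_onI)
    then show ?thesis by (simp add: measurable_completion)
  qed
  have "(\<lambda>n. \<integral>x. indicat_real \<Omega> x *\<^sub>R (f x * box_bump a b (real n) x) \<partial>lebesgue)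
      \<longlonglongrightarrow> (\<integral>x. indicat_real (box a b) x *\<^sub>R f x \<partial>lebesgue)"
  \<comment> \<open>The bumps lie between 0 and 1 and vanish off the box, so the absolute value of f
    on the closed box dominates for all n.\<close>
  proof (rule integral_dominated_convergence[where w="\<lambda>x. norm (indicator (cbox a b) x *\<^sub>R f x)"])
    show "(\<lambda>x. indicat_real (box a b) x *\<^sub>R f x) \<in> borel_measurable lebesgue"
      using b unfolding set_integrable_def by (rule borel_measurable_integrable)
    show "(\<lambda>x. indicat_real \<Omega> x *\<^sub>R (f x * box_bump a b (real n) x)) \<in> borel_measurable lebesgue" for n
      using borel_measurable_times[OF m bm[of "real n"]] by (simp add: mult.assoc)
    show "integrable lebesgue (\<lambda>x. norm (indicat_real (cbox a b) x *\<^sub>R f x))"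
      using int by (rule integrable_norm)
    have "(\<lambda>n. indicat_real \<Omega> x *\<^sub>R (f x * box_bump a b (real n) x))
        \<longlonglongrightarrow> indicat_real \<Omega> x *\<^sub>R (f x * indicat_real (box a b) x)" for x
      by (intro tendsto_scaleR tendsto_mult tendsto_const box_bump_tendsto)
    moreover have "indicat_real \<Omega> x *\<^sub>R (f x * indicat_real (box a b) x) = indicat_real (box a b) x *\<^sub>R f x" for x
      using sub box_subset_cbox[of a b] by (auto simp: indicator_def)
    ultimately have "(\<lambda>n. indicat_real \<Omega> x *\<^sub>R (f x * box_bump a b (real n) x))
        \<longlonglongrightarrow> indicat_real (box a b) x *\<^sub>R f x" for x
      by metis
    then show "AE x in lebesgue. (\<lambda>n. indicat_real \<Omega> x *\<^sub>R (f x * box_bump a b (real n) x))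
        \<longlonglongrightarrow> indicat_real (box a b) x *\<^sub>R f x"
      by (rule AE_I2)
    have "norm (indicat_real \<Omega> x *\<^sub>R (f x * box_bump a b (real n) x)) \<le> norm (indicat_real (cbox a b) x *\<^sub>R f x)" for x n
    proof (cases "x \<in> box a b")
      case True
      have "\<bar>f x\<bar> * \<bar>box_bump a b (real n) x\<bar> \<le> \<bar>f x\<bar> * 1"
        using box_bump_bounds[of a b "real n" x] by (intro mult_left_mono) simp_all
      then show ?thesis
        using True sub box_subset_cbox[of a b] by (auto simp: abs_mult indicator_def)
    next
      case False
      then show ?thesis by (simp add: box_bump_eq_0)
    qed
    then show "AE x in lebesgue. norm (indicat_real \<Omega> x *\<^sub>R (f x * box_bump a b (real n) x))
        \<le> norm (indicat_real (cbox a b) x *\<^sub>R f x)" for n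
      by simp
  qed
  moreover have "(\<integral>x. indicat_real \<Omega> x *\<^sub>R (f x * box_bump a b (real n) x) \<partial>lebesgue) = 0" for n
    using zero[OF box_bump_test_function[OF _ sub, of "real n"]] sets
    by (simp add: integral_restrict_space)
  ultimately have "(\<integral>x. indicat_real (box a b) x *\<^sub>R f x \<partial>lebesgue) = 0"
    by (simp only: LIMSEQ_const_iff)
  then have "integral (box a b) f = 0"
    using set_lebesgue_integral_eq_integral(2)[OF b] by (simp add: set_lebesgue_integral_def)
  then show "integral (cbox a b) f = 0"
    by (simp add: integral_open_interval)
qed

text \<open>Lebesgue differentiation: at almost every point x the value is the limit of averages
  over the cubes with lower corner x, and these averages vanish once the cube fits into
  \<open>cbox a b\<close>.\<close>

lemma AE_eq_0_if_box_integrals_eq_0: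
  fixes f :: "'a::euclidean_space \<Rightarrow> real"
  assumes int: "f integrable_on cbox a b"
    and zero: "\<And>c d. cbox c d \<subseteq> cbox a b \<Longrightarrow> integral (cbox c d) f = 0"
  shows "AE x in lebesgue. x \<in> cbox a b \<longrightarrow> f x = 0"
proof -
  \<comment> \<open>Extension by zero, because the differentiation theorem asks for integrability on
    every box.\<close>
  define g where "g x = (if x \<in> cbox a b then f x else 0)" for x
  have "g integrable_on cbox c d" for c d
  proof (rule integrable_on_subcbox)
    show "g integrable_on UNIV"
      using int unfolding g_def integrable_restrict_UNIV .
  qed simp
  then obtain N where N: "negligible N"
    "\<And>x e. \<lbrakk>x \<notin> N; 0 < e\<rbrakk> \<Longrightarrow> \<exists>r>0. \<forall>h. 0 < h \<and> h < r \<longrightarrow>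
       norm (integral (cbox x (x + h *\<^sub>R One)) g /\<^sub>R h ^ DIM('a) - g x) < e"
    using integrable_ccontinuous_explicit[of g] by blast
  have f0: "f x = 0" if x: "x \<in> box a b" "x \<notin> N" for x
  proof (rule ccontr)
    assume "f x \<noteq> 0"
    \<comment> \<open>With tolerance \<open>\<bar>f x\<bar>\<close>, an average equal to 0 gives the
      contradiction \<open>\<bar>f x\<bar> < \<bar>f x\<bar>\<close>.\<close>
    then obtain r where r: "r > 0" "\<And>h. 0 < h \<Longrightarrow> h < r \<Longrightarrow>
        norm (integral (cbox x (x + h *\<^sub>R One)) g /\<^sub>R h ^ DIM('a) - g x) < \<bar>f x\<bar>"
      using N(2)[OF x(2), of "\<bar>f x\<bar>"] by auto
    \<comment> \<open>The smallest distance from x to the upper faces; the lower faces cause no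
      constraint, as x is the lower corner of the cube.\<close>
    define m where "m = Min ((\<lambda>i. b \<bullet> i - x \<bullet> i) ` Basis)"
    have m: "m > 0" "\<And>i. i \<in> Basis \<Longrightarrow> m \<le> b \<bullet> i - x \<bullet> i"
      using x(1) by (auto simp: m_def mem_box)
    define h where "h = min r m / 2"
    have h: "0 < h" "h < r" "h \<le> m" using r(1) m(1) by (auto simp: h_def)
    have sub: "cbox x (x + h *\<^sub>R One) \<subseteq> cbox a b"
    proof (rule subset_box_imp(1)[rule_format])
      fix i :: 'a assume i: "i \<in> Basis"
      then show "a \<bullet> i \<le> x \<bullet> i \<and> (x + h *\<^sub>R One) \<bullet> i \<le> b \<bullet> i"
        using x(1) m(2)[OF i] h(3) by (simp add: mem_box inner_add_left less_imp_le)
    qed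
    have "integral (cbox x (x + h *\<^sub>R One)) g = integral (cbox x (x + h *\<^sub>R One)) f"
      using sub by (intro integral_cong) (auto simp: g_def)
    then show False
      using r(2)[OF h(1,2)] zero[OF sub] x(1) box_subset_cbox[of a b] by (auto simp: g_def)
  qed
  have "negligible (N \<union> (cbox a b - box a b))"
    using N(1) negligible_frontier_interval by (rule negligible_Un)
  then show ?thesis
    unfolding negligible_iff_null_sets by (rule AE_I') (use f0 in blast)
qed

text \<open>An open set is a countable union of closed boxes, so the exceptional null sets of the
  boxes combine to a null set.\<close>

lemma fundamental_lemma_calculus_of_variations:
  fixes f :: "'a::euclidean_space \<Rightarrow> real"
  assumes \<Omega>: "open \<Omega>" and f: "locally_integrable \<Omega> f"
    and zero: "\<And>\<phi>. \<phi> \<in> test_functions \<Omega> \<Longrightarrow> (\<integral>x. f x * \<phi> x \<partial>lebesgue_on \<Omega>) = 0"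
  shows "AE x in lebesgue_on \<Omega>. f x = 0"
proof -
  obtain \<D> where D: "countable \<D>" "\<D> \<subseteq> Pow \<Omega>" "\<And>X. X \<in> \<D> \<Longrightarrow> \<exists>a b. X = cbox a b" "\<Union>\<D> = \<Omega>"
    using open_countable_Union_open_cbox[OF \<Omega>] by metis
  have "AE x in lebesgue. x \<in> X \<longrightarrow> f x = 0" if X: "X \<in> \<D>" for X
  proof -
    obtain a b where ab: "X = cbox a b" using D(3)[OF X] by blast
    then have sub: "cbox a b \<subseteq> \<Omega>" using D(2) X by auto
    show ?thesis
      unfolding ab
    proof (rule AE_eq_0_if_box_integrals_eq_0)
      show "f integrable_on cbox a b"
        by (rule box_integral_eq_0(1)[OF \<Omega> f zero sub])
      show "integral (cbox c d) f = 0" if "cbox c d \<subseteq> cbox a b" for c d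
        by (rule box_integral_eq_0(2)[OF \<Omega> f zero subset_trans[OF that sub]])
    qed
  qed
  then have "AE x in lebesgue. \<forall>X\<in>\<D>. x \<in> X \<longrightarrow> f x = 0"
    by (subst AE_ball_countable[OF D(1)]) (rule ballI)
  then have "AE x in lebesgue. x \<in> \<Omega> \<longrightarrow> f x = 0"
    by (rule eventually_mono) (use D(4) in blast)
  then show ?thesis
    using \<Omega> by (subst AE_restrict_space_iff) auto
qed

section \<open>Uniqueness and linearity of weak gradients\<close>

lemma locally_integrable_diff:
  assumes "locally_integrable \<Omega> f" "locally_integrable \<Omega> g"
  shows "locally_integrable \<Omega> (\<lambda>x. f x - g x)"
  unfolding locally_integrable_def
proof (intro conjI allI impI)
  show "(\<lambda>x. f x - g x) \<in> borel_measurable (lebesgue_on \<Omega>)"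
    using assms unfolding locally_integrable_def by (intro borel_measurable_diff) simp_all
  show "integrable (lebesgue_on K) (\<lambda>x. f x - g x)" if "compact K \<and> K \<subseteq> \<Omega>" for K
    using assms that unfolding locally_integrable_def by (intro Bochner_Integration.integrable_diff) simp_all
qed

lemma locally_integrable_inner:
  assumes "locally_integrable \<Omega> f"
  shows "locally_integrable \<Omega> (\<lambda>x. f x \<bullet> b)"
  unfolding locally_integrable_def
proof (intro conjI allI impI)
  show "(\<lambda>x. f x \<bullet> b) \<in> borel_measurable (lebesgue_on \<Omega>)"
    using assms unfolding locally_integrable_def by (intro borel_measurable_inner) simp_all
  show "integrable (lebesgue_on K) (\<lambda>x. f x \<bullet> b)" if "compact K \<and> K \<subseteq> \<Omega>" for K
    using assms that unfolding locally_integrable_def by (intro integrable_inner_left) simp_all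
qed

lemma has_weak_gradientD:
  assumes "has_weak_gradient \<Omega> u V"
  shows "locally_integrable \<Omega> u" "locally_integrable \<Omega> V"
    and "\<phi> \<in> test_functions \<Omega> \<Longrightarrow> b \<in> Basis \<Longrightarrow>
      (\<integral>x. u x * frechet_derivative \<phi> (at x) b \<partial>lebesgue_on \<Omega>) =
        - (\<integral>x. (V x \<bullet> b) * \<phi> x \<partial>lebesgue_on \<Omega>)"
  using assms unfolding has_weak_gradient_def by simp_all

lemma integrable_mult_test_function:
  fixes f :: "'a::euclidean_space \<Rightarrow> real"
  assumes \<Omega>: "open \<Omega>" and f: "locally_integrable \<Omega> f"
    and \<phi>: "\<phi> \<in> test_functions \<Omega>" and b: "b \<in> Basis"
  shows "integrable (lebesgue_on \<Omega>) (\<lambda>x. f x * \<phi> x)"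
    "integrable (lebesgue_on \<Omega>) (\<lambda>x. f x * frechet_derivative \<phi> (at x) b)"
proof -
  obtain K where K: "compact K" "K \<subseteq> \<Omega>" "\<forall>x. x \<notin> K \<longrightarrow> \<phi> x = 0"
      "\<forall>x. x \<notin> K \<longrightarrow> frechet_derivative \<phi> (at x) b = 0"
      "continuous_on UNIV \<phi>" "continuous_on UNIV (\<lambda>x. frechet_derivative \<phi> (at x) b)"
    using \<phi> b by (rule test_functionE)
  have "integrable (lebesgue_on \<Omega>) (\<lambda>x. f x * \<psi> x)"
    if "\<forall>x. x \<notin> K \<longrightarrow> \<psi> x = 0" "continuous_on UNIV \<psi>" for \<psi>
  proof -
    have "integrable (lebesgue_on \<Omega>) (\<lambda>x. \<psi> x *\<^sub>R f x)"
      by (rule integrable_compact_support_scaleR[OF \<Omega> f K(1,2) _ that(2)]) (use that(1) in blast)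
    then show ?thesis by (simp add: mult.commute)
  qed
  from this[OF K(3,5)] this[OF K(4,6)]
  show "integrable (lebesgue_on \<Omega>) (\<lambda>x. f x * \<phi> x)"
    "integrable (lebesgue_on \<Omega>) (\<lambda>x. f x * frechet_derivative \<phi> (at x) b)"
    by this
qed

text \<open>The Bochner integral defaults to 0 on non-integrable functions, so splitting requires
  each product to be integrable; compact support of \<open>\<phi>\<close> and local integrability
  provide this.\<close>

lemma integral_diff_mult_test_function:
  fixes f g :: "'a::euclidean_space \<Rightarrow> real"
  assumes \<Omega>: "open \<Omega>" and f: "locally_integrable \<Omega> f" and g: "locally_integrable \<Omega> g"
    and \<phi>: "\<phi> \<in> test_functions \<Omega>" and b: "b \<in> Basis"
  shows "(\<integral>x. (f x - g x) * \<phi> x \<partial>lebesgue_on \<Omega>) =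
      (\<integral>x. f x * \<phi> x \<partial>lebesgue_on \<Omega>) - (\<integral>x. g x * \<phi> x \<partial>lebesgue_on \<Omega>)"
    "(\<integral>x. (f x - g x) * frechet_derivative \<phi> (at x) b \<partial>lebesgue_on \<Omega>) =
      (\<integral>x. f x * frechet_derivative \<phi> (at x) b \<partial>lebesgue_on \<Omega>)
      - (\<integral>x. g x * frechet_derivative \<phi> (at x) b \<partial>lebesgue_on \<Omega>)"
  unfolding left_diff_distrib
  by (intro Bochner_Integration.integral_diff integrable_mult_test_function[OF \<Omega> f \<phi> b]
      integrable_mult_test_function[OF \<Omega> g \<phi> b])+

text \<open>Against any test function, both components in direction b integrate to minus the same
  integral of u times the partial derivative, so the fundamental lemma applies to their difference.
  Finitely many directions keep the exceptional set null.\<close>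

lemma weak_gradient_unique:
  assumes \<Omega>: "open \<Omega>" and V: "has_weak_gradient \<Omega> u V" and W: "has_weak_gradient \<Omega> u W"
  shows "AE x in lebesgue_on \<Omega>. V x = W x"
proof -
  have "AE x in lebesgue_on \<Omega>. V x \<bullet> b - W x \<bullet> b = 0" if b: "b \<in> Basis" for b
  proof (rule fundamental_lemma_calculus_of_variations[OF \<Omega>])
    have loc: "locally_integrable \<Omega> (\<lambda>x. V x \<bullet> b)" "locally_integrable \<Omega> (\<lambda>x. W x \<bullet> b)"
      by (rule locally_integrable_inner[OF has_weak_gradientD(2)[OF V]]
          locally_integrable_inner[OF has_weak_gradientD(2)[OF W]])+
    then show "locally_integrable \<Omega> (\<lambda>x. V x \<bullet> b - W x \<bullet> b)"
      by (rule locally_integrable_diff)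
    fix \<phi> assume \<phi>: "\<phi> \<in> test_functions \<Omega>"
    show "(\<integral>x. (V x \<bullet> b - W x \<bullet> b) * \<phi> x \<partial>lebesgue_on \<Omega>) = 0"
      using integral_diff_mult_test_function(1)[OF \<Omega> loc \<phi> b]
        has_weak_gradientD(3)[OF V \<phi> b] has_weak_gradientD(3)[OF W \<phi> b] by linarith
  qed
  then have "AE x in lebesgue_on \<Omega>. \<forall>b\<in>Basis. V x \<bullet> b - W x \<bullet> b = 0"
    by (subst AE_ball_countable[OF countable_finite[OF finite_Basis]]) (rule ballI)
  then show ?thesis
  proof (rule eventually_mono)
    show "V x = W x" if "\<forall>b\<in>Basis. V x \<bullet> b - W x \<bullet> b = 0" for x
      by (rule euclidean_eqI) (use that in simp)
  qed
qed

lemma has_weak_gradient_diff: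
  assumes \<Omega>: "open \<Omega>" and u: "has_weak_gradient \<Omega> u V" and v: "has_weak_gradient \<Omega> v W"
  shows "has_weak_gradient \<Omega> (\<lambda>x. u x - v x) (\<lambda>x. V x - W x)"
  unfolding has_weak_gradient_def
proof (intro conjI ballI)
  show "locally_integrable \<Omega> (\<lambda>x. u x - v x)" "locally_integrable \<Omega> (\<lambda>x. V x - W x)"
    by (rule locally_integrable_diff has_weak_gradientD[OF u] has_weak_gradientD[OF v])+
  fix \<phi> and b :: 'a assume \<phi>: "\<phi> \<in> test_functions \<Omega>" and b: "b \<in> Basis"
  note loc = has_weak_gradientD(2)[OF u, THEN locally_integrable_inner, of b]
    has_weak_gradientD(2)[OF v, THEN locally_integrable_inner, of b]
  show "(\<integral>x. (u x - v x) * frechet_derivative \<phi> (at x) b \<partial>lebesgue_on \<Omega>) =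
      - (\<integral>x. ((V x - W x) \<bullet> b) * \<phi> x \<partial>lebesgue_on \<Omega>)"
    using integral_diff_mult_test_function(1)[OF \<Omega> loc \<phi> b]
      integral_diff_mult_test_function(2)[OF \<Omega> has_weak_gradientD(1)[OF u] has_weak_gradientD(1)[OF v] \<phi> b]
      has_weak_gradientD(3)[OF u \<phi> b] has_weak_gradientD(3)[OF v \<phi> b]
    unfolding inner_diff_left by linarith
qed

section \<open>Stability of weak solutions\<close>

text \<open>Openness is defined by balls around the points of the set itself, so the criterion holds
  for arbitrary functions d and d'; no triangle inequality has to be proved for the Sobolev
  norms.\<close>

lemma continuous_map_pseudometric_topology:
  assumes f: "\<And>x. x \<in> S \<Longrightarrow> f x \<in> T"
    and lim: "\<And>x e. x \<in> S \<Longrightarrow> e > 0 \<Longrightarrow> \<exists>\<delta>>0. \<forall>y\<in>S. d x y < \<delta> \<longrightarrow> d' (f x) (f y) < e"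
  shows "continuous_map (pseudometric_topology S d) (pseudometric_topology T d') f"
  unfolding continuous_map_def
proof (intro conjI allI impI)
  show "f \<in> topspace (pseudometric_topology S d) \<rightarrow> topspace (pseudometric_topology T d')"
    using f by simp
  fix U assume "openin (pseudometric_topology T d') U"
  then have U: "\<And>z. z \<in> U \<Longrightarrow> \<exists>e>0. \<forall>y\<in>T. d' z y < e \<longrightarrow> y \<in> U"
    by (simp add: openin_pseudometric_topology)
  have "\<exists>\<delta>>0. \<forall>y\<in>S. d x y < \<delta> \<longrightarrow> f y \<in> U" if x: "x \<in> S" "f x \<in> U" for x
  proof -
    obtain e where e: "e > 0" "\<forall>z\<in>T. d' (f x) z < e \<longrightarrow> z \<in> U"
      using U[OF x(2)] by blast
    obtain \<delta> where "\<delta> > 0" "\<forall>y\<in>S. d x y < \<delta> \<longrightarrow> d' (f x) (f y) < e"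
      using lim[OF x(1) e(1)] by blast
    with e(2) f show ?thesis by blast
  qed
  then show "openin (pseudometric_topology S d) {x \<in> topspace (pseudometric_topology S d). f x \<in> U}"
    by (simp add: openin_pseudometric_topology)
qed

lemma Lp_2_iff: "f \<in> Lp 2 M \<longleftrightarrow> f \<in> borel_measurable M \<and> integrable M (\<lambda>x. (norm (f x))\<^sup>2)"
proof -
  have "norm (f x) powr 2 = (norm (f x))\<^sup>2" for x
    by (cases "f x = 0") simp_all
  then show ?thesis by (simp add: Lp_def)
qed

lemma Lp_2_diff:
  assumes "f \<in> Lp 2 M" "g \<in> Lp 2 M"
  shows "(\<lambda>x. f x - g x) \<in> Lp 2 M"
proof -
  have m: "f \<in> borel_measurable M" "g \<in> borel_measurable M"
    and i: "integrable M (\<lambda>x. (norm (f x))\<^sup>2)" "integrable M (\<lambda>x. (norm (g x))\<^sup>2)"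
    using assms by (simp_all add: Lp_2_iff)
  note d = borel_measurable_diff[OF m]
  have "integrable M (\<lambda>x. (norm (f x - g x))\<^sup>2)"
  proof (rule Bochner_Integration.integrable_bound)
    show "integrable M (\<lambda>x. 2 * (norm (f x))\<^sup>2 + 2 * (norm (g x))\<^sup>2)"
      using i by (intro Bochner_Integration.integrable_add integrable_mult_right)
    show "(\<lambda>x. (norm (f x - g x))\<^sup>2) \<in> borel_measurable M"
      using measurable_compose[OF d borel_measurable_norm] by (rule borel_measurable_power)
    have "(norm (f x - g x))\<^sup>2 \<le> 2 * (norm (f x))\<^sup>2 + 2 * (norm (g x))\<^sup>2" for x
    proof -
      have "(norm (f x - g x))\<^sup>2 \<le> (norm (f x) + norm (g x))\<^sup>2"
        by (intro power_mono norm_triangle_ineq4 norm_ge_zero)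
      also have "\<dots> \<le> 2 * (norm (f x))\<^sup>2 + 2 * (norm (g x))\<^sup>2"
        using sum_squares_bound[of "norm (f x)" "norm (g x)"] by (simp add: power2_sum)
      finally show ?thesis .
    qed
    then show "AE x in M. norm ((norm (f x - g x))\<^sup>2) \<le> norm (2 * (norm (f x))\<^sup>2 + 2 * (norm (g x))\<^sup>2)"
      by (intro AE_I2) simp
  qed
  with d show ?thesis by (simp add: Lp_2_iff)
qed

text \<open>Cauchy-Schwarz together with the arithmetic-geometric mean inequality. On the reals the
  inner product is multiplication, so both gradients and scalar functions are covered.\<close>

lemma integrable_bounded_mult_inner:
  assumes a: "a \<in> borel_measurable M" "AE x in M. \<bar>a x\<bar> \<le> B"
    and fg: "f \<in> Lp 2 M" "g \<in> Lp 2 M"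
  shows "integrable M (\<lambda>x. a x * (f x \<bullet> g x))"
proof (rule Bochner_Integration.integrable_bound)
  have m: "f \<in> borel_measurable M" "g \<in> borel_measurable M"
    and i: "integrable M (\<lambda>x. (norm (f x))\<^sup>2)" "integrable M (\<lambda>x. (norm (g x))\<^sup>2)"
    using fg by (simp_all add: Lp_2_iff)
  show "integrable M (\<lambda>x. B * ((norm (f x))\<^sup>2 + (norm (g x))\<^sup>2))"
    using i by (intro Bochner_Integration.integrable_add integrable_mult_right)
  show "(\<lambda>x. a x * (f x \<bullet> g x)) \<in> borel_measurable M"
    using a(1) m by (intro borel_measurable_times borel_measurable_inner)
  have "norm (a x * (f x \<bullet> g x)) \<le> norm (B * ((norm (f x))\<^sup>2 + (norm (g x))\<^sup>2))" if "\<bar>a x\<bar> \<le> B" for x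
  proof -
    have "0 \<le> B" using that by linarith
    have "\<bar>f x \<bullet> g x\<bar> \<le> norm (f x) * norm (g x)"
      by (rule Cauchy_Schwarz_ineq2)
    also have "\<dots> \<le> (norm (f x))\<^sup>2 + (norm (g x))\<^sup>2"
    proof -
      have "0 \<le> norm (f x) * norm (g x)" by simp
      then show ?thesis
        using sum_squares_bound[of "norm (f x)" "norm (g x)"] by linarith
    qed
    finally have "\<bar>a x\<bar> * \<bar>f x \<bullet> g x\<bar> \<le> B * ((norm (f x))\<^sup>2 + (norm (g x))\<^sup>2)"
      using that by (intro mult_mono) simp_all
    with \<open>0 \<le> B\<close> show ?thesis by (simp add: abs_mult)
  qed
  with a(2) show "AE x in M. norm (a x * (f x \<bullet> g x)) \<le> norm (B * ((norm (f x))\<^sup>2 + (norm (g x))\<^sup>2))"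
    by (rule eventually_mono)
qed

text \<open>Split \<open>f\<close> at a height \<open>n\<close>: where \<open>f > n\<close> the integrand is at most \<open>B\<^sup>2 f\<close>, whose integral over
  that region is small; elsewhere it is at most \<open>B n \<bar>h\<bar>\<close>.\<close>

lemma integral_square_mult_small:
  fixes f :: "'a \<Rightarrow> real"
  assumes f: "integrable M f" "\<And>x. 0 \<le> f x" and B: "0 \<le> B" and e: "0 < e"
  shows "\<exists>\<delta>>0. \<forall>h. integrable M h \<longrightarrow> (AE x in M. \<bar>h x\<bar> \<le> B) \<longrightarrow> (\<integral>x. \<bar>h x\<bar> \<partial>M) < \<delta>
    \<longrightarrow> (\<integral>x. (h x)\<^sup>2 * f x \<partial>M) < e"
proof -
  define T where "T n x = (if f x > real n then f x else 0)" for n x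
  have fm: "f \<in> borel_measurable M" using f(1) by (rule borel_measurable_integrable)
  have Tm: "T n \<in> borel_measurable M" for n
    unfolding T_def[abs_def] by (intro measurable_If borel_measurable_const fm borel_measurable_less pred_intros_logic) (use fm in measurable)
  have Ti: "integrable M (T n)" for n
    by (rule Bochner_Integration.integrable_bound[OF f(1) Tm]) (auto simp: T_def f(2))
  \<comment> \<open>The tails of an integrable function have vanishing integrals: at each x,
    \<open>T n x\<close> is 0 as soon as n reaches \<open>f x\<close>, and f dominates.\<close>
  have "(\<lambda>n. \<integral>x. T n x \<partial>M) \<longlonglongrightarrow> (\<integral>x. 0 \<partial>M)"
  proof (rule integral_dominated_convergence[where w=f, OF _ Tm f(1)])
    have "(\<lambda>n. T n x) \<longlonglongrightarrow> 0" for x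
    proof (rule tendsto_eventually)
      obtain n where n: "f x \<le> real n" using real_arch_simple by blast
      show "\<forall>\<^sub>F n in sequentially. T n x = 0"
        by (rule eventually_sequentiallyI[of n]) (use n in \<open>simp add: T_def\<close>)
    qed
    then show "AE x in M. (\<lambda>n. T n x) \<longlonglongrightarrow> 0" by simp
    show "AE x in M. norm (T n x) \<le> f x" for n
      by (rule AE_I2) (simp add: T_def f(2))
  qed simp
  then have "(\<lambda>n. B\<^sup>2 * (\<integral>x. T n x \<partial>M)) \<longlonglongrightarrow> B\<^sup>2 * 0"
    by (intro tendsto_mult_left) simp
  then have "\<forall>\<^sub>F n in sequentially. B\<^sup>2 * (\<integral>x. T n x \<partial>M) < e / 2"
    by (rule order_tendstoD(2)) (use e in simp)
  then obtain n where n: "B\<^sup>2 * (\<integral>x. T n x \<partial>M) < e / 2"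
    by (auto simp: eventually_sequentially)
  \<comment> \<open>The summand 1 keeps the denominator positive when \<open>B * real n\<close> is 0
    and allows the strict estimate below; the contribution of the region \<open>f \<le> n\<close> is
    then less than e/2.\<close>
  define \<delta> where "\<delta> = e / (2 * (B * real n + 1))"
  have Bn: "0 < B * real n + 1" using B by (simp add: add_nonneg_pos)
  have "\<delta> > 0" using e Bn by (simp add: \<delta>_def)
  moreover have "(\<integral>x. (h x)\<^sup>2 * f x \<partial>M) < e"
    if h: "integrable M h" "AE x in M. \<bar>h x\<bar> \<le> B" "(\<integral>x. \<bar>h x\<bar> \<partial>M) < \<delta>" for h
  proof -
    have sq: "(h x)\<^sup>2 \<le> B\<^sup>2" if "\<bar>h x\<bar> \<le> B" for x
      using power_mono[OF that abs_ge_zero, of 2] by simp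
    have int: "integrable M (\<lambda>x. (h x)\<^sup>2 * f x)"
    proof (rule Bochner_Integration.integrable_bound[OF integrable_mult_right[OF f(1), of "B\<^sup>2"]])
      show "(\<lambda>x. (h x)\<^sup>2 * f x) \<in> borel_measurable M"
        using borel_measurable_integrable[OF h(1)] fm by (intro borel_measurable_times borel_measurable_power)
      show "AE x in M. norm ((h x)\<^sup>2 * f x) \<le> norm (B\<^sup>2 * f x)"
        using h(2) by (rule eventually_mono) (simp add: abs_mult f(2) mult_right_mono sq)
    qed
    have "(\<integral>x. (h x)\<^sup>2 * f x \<partial>M) \<le> (\<integral>x. B\<^sup>2 * T n x + B * real n * \<bar>h x\<bar> \<partial>M)"
    proof (rule integral_mono_AE[OF int])
      show "integrable M (\<lambda>x. B\<^sup>2 * T n x + B * real n * \<bar>h x\<bar>)"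
        using Ti h(1) by (intro Bochner_Integration.integrable_add integrable_mult_right integrable_abs)
      have "(h x)\<^sup>2 * f x \<le> B\<^sup>2 * T n x + B * real n * \<bar>h x\<bar>" if hx: "\<bar>h x\<bar> \<le> B" for x
      proof (cases "f x > real n")
        case True
        then have "(h x)\<^sup>2 * f x \<le> B\<^sup>2 * T n x"
          using sq[OF hx] f(2)[of x] by (simp add: T_def mult_right_mono)
        moreover have "0 \<le> B * real n * \<bar>h x\<bar>" using B by simp
        ultimately show ?thesis by linarith
      next
        case False
        have "(h x)\<^sup>2 = \<bar>h x\<bar> * \<bar>h x\<bar>" by (simp add: power2_eq_square)
        also have "\<dots> \<le> B * \<bar>h x\<bar>" using hx by (intro mult_right_mono) simp_all
        finally have "(h x)\<^sup>2 * f x \<le> (B * \<bar>h x\<bar>) * real n"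
          using False f(2)[of x] B by (intro mult_mono) simp_all
        then show ?thesis using False by (simp add: T_def mult_ac)
      qed
      with h(2) show "AE x in M. (h x)\<^sup>2 * f x \<le> B\<^sup>2 * T n x + B * real n * \<bar>h x\<bar>"
        by (rule eventually_mono)
    qed
    also have "\<dots> = B\<^sup>2 * (\<integral>x. T n x \<partial>M) + B * real n * (\<integral>x. \<bar>h x\<bar> \<partial>M)"
      using Ti[of n] h(1) by simp
    also have "B * real n * (\<integral>x. \<bar>h x\<bar> \<partial>M) \<le> (B * real n + 1) * (\<integral>x. \<bar>h x\<bar> \<partial>M)"
      by (intro mult_right_mono) simp_all
    also have "(B * real n + 1) * (\<integral>x. \<bar>h x\<bar> \<partial>M) < (B * real n + 1) * \<delta>"
      using h(3) Bn by (rule mult_strict_left_mono)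
    also have "(B * real n + 1) * \<delta> = e / 2"
    proof -
      have "k * (e / (2 * k)) = e / 2" if "0 < k" for k :: real
        using that by simp
      from this[OF Bn] show ?thesis unfolding \<delta>_def .
    qed
    finally show ?thesis using n by linarith
  qed
  ultimately show ?thesis by blast
qed

section \<open>Choice of the gradient, and null sets on the boundary\<close>

text \<open>\<open>weak_gradient\<close> chooses some weak gradient, not necessarily the
  square-integrable one that membership in \<open>H1\<close> provides. Uniqueness almost everywhere
  transfers square integrability to the chosen one.\<close>

lemma H1_D:
  assumes \<Omega>: "open \<Omega>" and u: "u \<in> H1 \<Omega>"
  shows "u \<in> Lp 2 (lebesgue_on \<Omega>)" "has_weak_gradient \<Omega> u (weak_gradient \<Omega> u)"
    "weak_gradient \<Omega> u \<in> Lp 2 (lebesgue_on \<Omega>)"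
proof -
  show "u \<in> Lp 2 (lebesgue_on \<Omega>)" using u by (simp add: W1_def)
  obtain V where V: "V \<in> Lp 2 (lebesgue_on \<Omega>)" "has_weak_gradient \<Omega> u V"
    using u by (auto simp: W1_def)
  show w: "has_weak_gradient \<Omega> u (weak_gradient \<Omega> u)"
    unfolding weak_gradient_def by (rule someI[of _ V]) (rule V(2))
  have m: "weak_gradient \<Omega> u \<in> borel_measurable (lebesgue_on \<Omega>)"
    using has_weak_gradientD(2)[OF w] by (simp add: locally_integrable_def)
  have "integrable (lebesgue_on \<Omega>) (\<lambda>x. (norm (weak_gradient \<Omega> u x))\<^sup>2) \<longleftrightarrow>
      integrable (lebesgue_on \<Omega>) (\<lambda>x. (norm (V x))\<^sup>2)"
  proof (rule integrable_cong_AE)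
    show "AE x in lebesgue_on \<Omega>. (norm (weak_gradient \<Omega> u x))\<^sup>2 = (norm (V x))\<^sup>2"
      using weak_gradient_unique[OF \<Omega> w V(2)] by (rule eventually_mono) simp
    show "(\<lambda>x. (norm (weak_gradient \<Omega> u x))\<^sup>2) \<in> borel_measurable (lebesgue_on \<Omega>)"
      using m by measurable
    have "V \<in> borel_measurable (lebesgue_on \<Omega>)" using V(1) by (simp add: Lp_2_iff)
    then show "(\<lambda>x. (norm (V x))\<^sup>2) \<in> borel_measurable (lebesgue_on \<Omega>)" by measurable
  qed
  with m V(1) show "weak_gradient \<Omega> u \<in> Lp 2 (lebesgue_on \<Omega>)"
    by (simp add: Lp_2_iff)
qed

text \<open>The gradient of the difference is chosen independently of the other two, so linearity
  can be expected only almost everywhere.\<close>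

lemma H1_diff:
  assumes \<Omega>: "open \<Omega>" and u: "u \<in> H1 \<Omega>" and v: "v \<in> H1 \<Omega>"
  shows "(\<lambda>x. u x - v x) \<in> H1 \<Omega>"
    "AE x in lebesgue_on \<Omega>. weak_gradient \<Omega> (\<lambda>x. u x - v x) x = weak_gradient \<Omega> u x - weak_gradient \<Omega> v x"
proof -
  note uv = H1_D[OF \<Omega> u] H1_D[OF \<Omega> v]
  have g: "has_weak_gradient \<Omega> (\<lambda>x. u x - v x) (\<lambda>x. weak_gradient \<Omega> u x - weak_gradient \<Omega> v x)"
    by (rule has_weak_gradient_diff[OF \<Omega> uv(2,5)])
  show h: "(\<lambda>x. u x - v x) \<in> H1 \<Omega>"
    using Lp_2_diff[OF uv(1,4)] Lp_2_diff[OF uv(3,6)] g unfolding W1_def by auto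
  show "AE x in lebesgue_on \<Omega>. weak_gradient \<Omega> (\<lambda>x. u x - v x) x = weak_gradient \<Omega> u x - weak_gradient \<Omega> v x"
    by (rule weak_gradient_unique[OF \<Omega> H1_D(2)[OF \<Omega> h] g])
qed

text \<open>The trace is linear only almost everywhere, so the boundary norm must ignore null sets.
  In the double integral, exceptional x are discarded by the outer integral and exceptional y by the
  inner one.\<close>

lemma Wfrac_norm_cong_AE:
  assumes m: "f \<in> borel_measurable (surface_measure \<Gamma>)" "h \<in> borel_measurable (surface_measure \<Gamma>)"
    and eq: "AE x in surface_measure \<Gamma>. f x = h x"
  shows "Wfrac_norm s q \<Gamma> f = Wfrac_norm s q \<Gamma> h"
proof -
  let ?M = "surface_measure \<Gamma>"
  have "(\<integral>x. \<bar>f x\<bar> powr q \<partial>?M) = (\<integral>x. \<bar>h x\<bar> powr q \<partial>?M)"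
  proof (rule integral_cong_AE)
    show "AE x in ?M. \<bar>f x\<bar> powr q = \<bar>h x\<bar> powr q"
      using eq by (rule eventually_mono) simp
  qed (use m in \<open>measurable\<close>)
  moreover have "slobodeckij s q \<Gamma> f = slobodeckij s q \<Gamma> h"
    unfolding slobodeckij_def
  proof (rule nn_integral_cong_AE, rule eventually_mono[OF eq])
    fix x assume x: "f x = h x"
    show "(\<integral>\<^sup>+y. ennreal (\<bar>f x - f y\<bar> powr q / dist x y powr (real (DIM('a) - 1) + s * q)) \<partial>?M) =
        (\<integral>\<^sup>+y. ennreal (\<bar>h x - h y\<bar> powr q / dist x y powr (real (DIM('a) - 1) + s * q)) \<partial>?M)"
      by (rule nn_integral_cong_AE, rule eventually_mono[OF eq]) (simp add: x)
  qed
  ultimately show ?thesis by (simp add: Wfrac_norm_def)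
qed

section \<open>Coercivity and the stability estimate\<close>

text \<open>Here x stands for the field of the fixed solution and y for the difference, so x - y is
  the other field. The right side equals (a - a') (x . y) + a' |y|^2, and Young's inequality bounds
  the mixed term from below.\<close>

lemma coercive_inner_bound:
  fixes x y :: "'b::real_inner"
  assumes m: "0 < m" "m \<le> a'"
  shows "m / 2 * (norm y)\<^sup>2 - (a - a')\<^sup>2 * (norm x)\<^sup>2 / (2 * m) \<le> a * (x \<bullet> y) - a' * ((x - y) \<bullet> y)"
proof -
  \<comment> \<open>Divided by 2 m, this square is Young's inequality weighted so that exactly half
    of the coercive term m |y|^2 survives.\<close>
  have "0 \<le> (norm (m *\<^sub>R y + (a - a') *\<^sub>R x))\<^sup>2" by simp
  also have "\<dots> = m\<^sup>2 * (norm y)\<^sup>2 + 2 * m * ((a - a') * (x \<bullet> y)) + (a - a')\<^sup>2 * (norm x)\<^sup>2"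
    unfolding power2_norm_eq_inner
    by (simp add: inner_add_left inner_add_right inner_commute power2_eq_square algebra_simps)
  finally have "0 \<le> (m\<^sup>2 * (norm y)\<^sup>2 + 2 * m * ((a - a') * (x \<bullet> y)) + (a - a')\<^sup>2 * (norm x)\<^sup>2) / (2 * m)"
    using m(1) by simp
  also have "\<dots> = m / 2 * (norm y)\<^sup>2 + (a - a') * (x \<bullet> y) + (a - a')\<^sup>2 * (norm x)\<^sup>2 / (2 * m)"
    using m(1) by (simp add: field_simps power2_eq_square)
  finally have 1: "0 \<le> m / 2 * (norm y)\<^sup>2 + (a - a') * (x \<bullet> y) + (a - a')\<^sup>2 * (norm x)\<^sup>2 / (2 * m)" .
  have 2: "m * (norm y)\<^sup>2 \<le> a' * (norm y)\<^sup>2" using m(2) by (simp add: mult_right_mono)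
  have 3: "a * (x \<bullet> y) - a' * ((x - y) \<bullet> y) = (a - a') * (x \<bullet> y) + a' * (norm y)\<^sup>2"
    unfolding power2_norm_eq_inner by (simp add: inner_diff_left algebra_simps)
  from 1 2 show ?thesis unfolding 3 by linarith
qed

text \<open>Generic in the value type so that it applies both to the gradients with coefficient a
  and to the scalar functions with coefficient c.\<close>

lemma coercive_integral_bound:
  fixes f :: "'a \<Rightarrow> 'b::euclidean_space"
  assumes m: "0 < m"
    and a: "a \<in> borel_measurable M" "AE x in M. m \<le> a x \<and> a x \<le> B"
    and a': "a' \<in> borel_measurable M" "AE x in M. m \<le> a' x \<and> a' x \<le> B"
    and L2: "f \<in> Lp 2 M" "f' \<in> Lp 2 M" "d \<in> Lp 2 M"
    and d: "AE x in M. d x = f x - f' x"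
  shows "m / 2 * (\<integral>x. (norm (d x))\<^sup>2 \<partial>M) - (\<integral>x. (a x - a' x)\<^sup>2 * (norm (f x))\<^sup>2 \<partial>M) / (2 * m)
    \<le> (\<integral>x. a x * (f x \<bullet> d x) \<partial>M) - (\<integral>x. a' x * (f' x \<bullet> d x) \<partial>M)"
proof -
  have "AE x in M. \<bar>a x\<bar> \<le> B" "AE x in M. \<bar>a' x\<bar> \<le> B"
    using m by (auto intro: eventually_mono[OF a(2)] eventually_mono[OF a'(2)])
  then have i: "integrable M (\<lambda>x. a x * (f x \<bullet> d x))" "integrable M (\<lambda>x. a' x * (f' x \<bullet> d x))"
    using integrable_bounded_mult_inner[OF a(1)] integrable_bounded_mult_inner[OF a'(1)] L2 by blast+
  have id: "integrable M (\<lambda>x. (norm (d x))\<^sup>2)"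
    using L2(3) by (simp add: Lp_2_iff)
  have "AE x in M. \<bar>(a x - a' x)\<^sup>2\<bar> \<le> B\<^sup>2"
    using a(2) a'(2)
  proof eventually_elim
    case (elim x)
    then have "\<bar>a x - a' x\<bar> \<le> B" using m by linarith
    from power_mono[OF this abs_ge_zero, of 2] show ?case by simp
  qed
  \<comment> \<open>The integrability lemma with f in both slots, since f . f = |f|^2.\<close>
  from integrable_bounded_mult_inner[OF borel_measurable_power[OF borel_measurable_diff[OF a(1) a'(1)]] this L2(1,1)]
  have ia: "integrable M (\<lambda>x. (a x - a' x)\<^sup>2 * (norm (f x))\<^sup>2)"
    by (simp only: power2_norm_eq_inner)
  have "(\<integral>x. m / 2 * (norm (d x))\<^sup>2 - (a x - a' x)\<^sup>2 * (norm (f x))\<^sup>2 / (2 * m) \<partial>M)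
      \<le> (\<integral>x. a x * (f x \<bullet> d x) - a' x * (f' x \<bullet> d x) \<partial>M)"
  proof (rule integral_mono_AE)
    show "integrable M (\<lambda>x. m / 2 * (norm (d x))\<^sup>2 - (a x - a' x)\<^sup>2 * (norm (f x))\<^sup>2 / (2 * m))"
      by (intro Bochner_Integration.integrable_diff integrable_mult_right integrable_divide id ia)
    show "integrable M (\<lambda>x. a x * (f x \<bullet> d x) - a' x * (f' x \<bullet> d x))"
      by (intro Bochner_Integration.integrable_diff i)
    show "AE x in M. m / 2 * (norm (d x))\<^sup>2 - (a x - a' x)\<^sup>2 * (norm (f x))\<^sup>2 / (2 * m)
        \<le> a x * (f x \<bullet> d x) - a' x * (f' x \<bullet> d x)"
      using d a'(2)
    proof eventually_elim
      case (elim x)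
      then have "f' x = f x - d x" by simp
      then show ?case
        using coercive_inner_bound[OF m, of "a' x" "d x" "a x" "f x"] elim by simp
    qed
  qed
  then show ?thesis
    using i id ia by simp
qed

lemma H1_norm_nonneg: "0 \<le> H1_norm \<Omega> u"
  by (simp add: H1_norm_def)

lemma H1_norm_power2:
  "(H1_norm \<Omega> u)\<^sup>2 = (\<integral>x. (u x)\<^sup>2 \<partial>lebesgue_on \<Omega>) + (\<integral>x. (norm (weak_gradient \<Omega> u x))\<^sup>2 \<partial>lebesgue_on \<Omega>)"
  by (simp add: H1_norm_def)

text \<open>Both weak formulations are tested with \<open>u - u'\<close>, so the two boundary terms are equal, whatever
  the functional \<open>g\<close> is.\<close>

lemma weak_solution_stability:
  assumes \<Omega>: "open \<Omega>" and bounds: "0 < al" "0 < cl"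
    and ac: "(a, c) \<in> admissible \<Omega> al au cl cu" "(a', c') \<in> admissible \<Omega> al au cl cu"
    and sol: "weak_solution \<Omega> \<gamma> a c g u" "weak_solution \<Omega> \<gamma> a' c' g u'"
  shows "(min al cl)\<^sup>2 * (H1_norm \<Omega> (\<lambda>x. u x - u' x))\<^sup>2 \<le>
    (\<integral>x. (a x - a' x)\<^sup>2 * (norm (weak_gradient \<Omega> u x))\<^sup>2 \<partial>lebesgue_on \<Omega>) +
    (\<integral>x. (c x - c' x)\<^sup>2 * (u x)\<^sup>2 \<partial>lebesgue_on \<Omega>)"
proof -
  let ?M = "lebesgue_on \<Omega>" and ?w = "\<lambda>x. u x - u' x" and ?m = "min al cl"
  let ?R = "\<integral>x. (a x - a' x)\<^sup>2 * (norm (weak_gradient \<Omega> u x))\<^sup>2 \<partial>?M"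
  let ?S = "\<integral>x. (c x - c' x)\<^sup>2 * (u x)\<^sup>2 \<partial>?M"
  have H1: "u \<in> H1 \<Omega>" "u' \<in> H1 \<Omega>" using sol by (simp_all add: weak_solution_def)
  note w = H1_diff[OF \<Omega> H1]
  note Du = H1_D[OF \<Omega> H1(1)] and Du' = H1_D[OF \<Omega> H1(2)] and Dw = H1_D[OF \<Omega> w(1)]
  have meas: "a \<in> borel_measurable ?M" "a' \<in> borel_measurable ?M"
    "c \<in> borel_measurable ?M" "c' \<in> borel_measurable ?M"
    using ac by (auto simp: admissible_def intro: borel_measurable_integrable)
  have AE: "AE x in ?M. al \<le> a x \<and> a x \<le> au" "AE x in ?M. al \<le> a' x \<and> a' x \<le> au"
    "AE x in ?M. cl \<le> c x \<and> c x \<le> cu" "AE x in ?M. cl \<le> c' x \<and> c' x \<le> cu"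
    using ac by (auto simp: admissible_def)
  \<comment> \<open>A common lower bound for both coefficients lets the two estimates add up to the
    full norm of \<open>H1\<close>.\<close>
  have bd: "AE x in ?M. ?m \<le> a x \<and> a x \<le> au" "AE x in ?M. ?m \<le> a' x \<and> a' x \<le> au"
    "AE x in ?M. ?m \<le> c x \<and> c x \<le> cu" "AE x in ?M. ?m \<le> c' x \<and> c' x \<le> cu"
    subgoal using AE(1) by eventually_elim linarith
    subgoal using AE(2) by eventually_elim linarith
    subgoal using AE(3) by eventually_elim linarith
    subgoal using AE(4) by eventually_elim linarith
    done
  have m: "0 < ?m" using bounds by simp
  have "?m / 2 * (\<integral>x. (norm (weak_gradient \<Omega> ?w x))\<^sup>2 \<partial>?M) - ?R / (2 * ?m)
      \<le> (\<integral>x. a x * (weak_gradient \<Omega> u x \<bullet> weak_gradient \<Omega> ?w x) \<partial>?M)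
        - (\<integral>x. a' x * (weak_gradient \<Omega> u' x \<bullet> weak_gradient \<Omega> ?w x) \<partial>?M)"
    by (rule coercive_integral_bound[OF m meas(1) bd(1) meas(2) bd(2) Du(3) Du'(3) Dw(3) w(2)])
  moreover have "?m / 2 * (\<integral>x. (?w x)\<^sup>2 \<partial>?M) - ?S / (2 * ?m)
      \<le> (\<integral>x. c x * u x * ?w x \<partial>?M) - (\<integral>x. c' x * u' x * ?w x \<partial>?M)"
    using coercive_integral_bound[OF m meas(3) bd(3) meas(4) bd(4) Du(1) Du'(1) Dw(1)]
    by (simp add: mult.assoc)
  moreover have "(\<integral>x. a x * (weak_gradient \<Omega> u x \<bullet> weak_gradient \<Omega> ?w x) \<partial>?M)
      + (\<integral>x. c x * u x * ?w x \<partial>?M) = g (\<gamma> ?w)"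
    by (rule bspec[OF conjunct2[OF sol(1)[unfolded weak_solution_def]] w(1)])
  moreover have "(\<integral>x. a' x * (weak_gradient \<Omega> u' x \<bullet> weak_gradient \<Omega> ?w x) \<partial>?M)
      + (\<integral>x. c' x * u' x * ?w x \<partial>?M) = g (\<gamma> ?w)"
    by (rule bspec[OF conjunct2[OF sol(2)[unfolded weak_solution_def]] w(1)])
  ultimately have "?m / 2 * (\<integral>x. (?w x)\<^sup>2 \<partial>?M) + ?m / 2 * (\<integral>x. (norm (weak_gradient \<Omega> ?w x))\<^sup>2 \<partial>?M)
      \<le> ?R / (2 * ?m) + ?S / (2 * ?m)"
    by linarith
  then have "?m / 2 * (H1_norm \<Omega> ?w)\<^sup>2 \<le> (?R + ?S) / (2 * ?m)"
    unfolding H1_norm_power2 distrib_left add_divide_distrib .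
  \<comment> \<open>Multiplying by 2 m turns the constants m/2 and 1/(2 m) into m^2 and 1.\<close>
  then have "2 * ?m * (?m / 2 * (H1_norm \<Omega> ?w)\<^sup>2) \<le> 2 * ?m * ((?R + ?S) / (2 * ?m))"
    using m by (intro mult_left_mono) simp_all
  moreover have "2 * ?m * (?m / 2 * (H1_norm \<Omega> ?w)\<^sup>2) = ?m\<^sup>2 * (H1_norm \<Omega> ?w)\<^sup>2"
    by (simp add: power2_eq_square)
  moreover have "2 * ?m * ((?R + ?S) / (2 * ?m)) = ?R + ?S"
  proof -
    have "2 * k * (s / (2 * k)) = s" if "0 < k" for k s :: real
      using that by simp
    from this[OF m] show ?thesis .
  qed
  ultimately show ?thesis by linarith
qed

section \<open>Continuity of the solution operator and of the forward map\<close>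

lemma parameter_to_solution_continuous_at:
  assumes \<Omega>: "open \<Omega>" and bounds: "0 < al" "al \<le> au" "0 < cl" "cl \<le> cu"
    and ac: "(a, c) \<in> admissible \<Omega> al au cl cu" and u: "weak_solution \<Omega> \<gamma> a c g u" and e: "0 < e"
  shows "\<exists>\<delta>>0. \<forall>a' c' u'. (a', c') \<in> admissible \<Omega> al au cl cu \<longrightarrow> weak_solution \<Omega> \<gamma> a' c' g u' \<longrightarrow>
    L1_norm \<Omega> (\<lambda>x. a x - a' x) + L1_norm \<Omega> (\<lambda>x. c x - c' x) < \<delta> \<longrightarrow> H1_norm \<Omega> (\<lambda>x. u x - u' x) < e"
proof -
  let ?M = "lebesgue_on \<Omega>" and ?m = "min al cl"
  have H1: "u \<in> H1 \<Omega>" using u by (simp add: weak_solution_def)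
  note Du = H1_D[OF \<Omega> H1]
  have m: "0 < ?m" using bounds by simp
  \<comment> \<open>Each of the two weighted integrals gets half of
    \<open>?m\<^sup>2 * e\<^sup>2\<close>, and the factor \<open>?m\<^sup>2\<close> cancels at the
    end.\<close>
  define \<epsilon> where "\<epsilon> = ?m\<^sup>2 * e\<^sup>2 / 2"
  have \<epsilon>: "0 < \<epsilon>"
    unfolding \<epsilon>_def by (intro divide_pos_pos mult_pos_pos zero_less_power m e) simp
  have i: "integrable ?M (\<lambda>x. (norm (weak_gradient \<Omega> u x))\<^sup>2)" "integrable ?M (\<lambda>x. (u x)\<^sup>2)"
    using Du by (simp_all add: Lp_2_iff)
  \<comment> \<open>Two values between al > 0 and au differ by at most au, which serves as the
    uniform bound B; cu plays this role for c.\<close>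
  obtain \<delta>1 where \<delta>1: "\<delta>1 > 0" "\<And>h. integrable ?M h \<Longrightarrow> AE x in ?M. \<bar>h x\<bar> \<le> au \<Longrightarrow> (\<integral>x. \<bar>h x\<bar> \<partial>?M) < \<delta>1
      \<Longrightarrow> (\<integral>x. (h x)\<^sup>2 * (norm (weak_gradient \<Omega> u x))\<^sup>2 \<partial>?M) < \<epsilon>"
    using integral_square_mult_small[OF i(1) _ _ \<epsilon>, of au] bounds by auto
  obtain \<delta>2 where \<delta>2: "\<delta>2 > 0" "\<And>h. integrable ?M h \<Longrightarrow> AE x in ?M. \<bar>h x\<bar> \<le> cu \<Longrightarrow> (\<integral>x. \<bar>h x\<bar> \<partial>?M) < \<delta>2
      \<Longrightarrow> (\<integral>x. (h x)\<^sup>2 * (u x)\<^sup>2 \<partial>?M) < \<epsilon>"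
    using integral_square_mult_small[OF i(2) _ _ \<epsilon>, of cu] bounds by auto
  have "H1_norm \<Omega> (\<lambda>x. u x - u' x) < e"
    if ac': "(a', c') \<in> admissible \<Omega> al au cl cu" and u': "weak_solution \<Omega> \<gamma> a' c' g u'"
      and small: "L1_norm \<Omega> (\<lambda>x. a x - a' x) + L1_norm \<Omega> (\<lambda>x. c x - c' x) < min \<delta>1 \<delta>2" for a' c' u'
  proof -
    have nn: "0 \<le> L1_norm \<Omega> f" for f by (simp add: L1_norm_def)
    have A: "integrable ?M a" "integrable ?M c" "AE x in ?M. al \<le> a x \<and> a x \<le> au" "AE x in ?M. cl \<le> c x \<and> c x \<le> cu"
      using ac by (auto simp: admissible_def)
    have A': "integrable ?M a'" "integrable ?M c'" "AE x in ?M. al \<le> a' x \<and> a' x \<le> au" "AE x in ?M. cl \<le> c' x \<and> c' x \<le> cu"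
      using ac' by (auto simp: admissible_def)
    have "AE x in ?M. \<bar>a x - a' x\<bar> \<le> au"
      using A(3) A'(3) by eventually_elim (use bounds in linarith)
    then have 1: "(\<integral>x. (a x - a' x)\<^sup>2 * (norm (weak_gradient \<Omega> u x))\<^sup>2 \<partial>?M) < \<epsilon>"
      using small nn[of "\<lambda>x. a x - a' x"] nn[of "\<lambda>x. c x - c' x"] unfolding L1_norm_def
      by (intro \<delta>1(2) Bochner_Integration.integrable_diff A A') linarith+
    have "AE x in ?M. \<bar>c x - c' x\<bar> \<le> cu"
      using A(4) A'(4) by eventually_elim (use bounds in linarith)
    then have 2: "(\<integral>x. (c x - c' x)\<^sup>2 * (u x)\<^sup>2 \<partial>?M) < \<epsilon>"
      using small nn[of "\<lambda>x. a x - a' x"] nn[of "\<lambda>x. c x - c' x"] unfolding L1_norm_def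
      by (intro \<delta>2(2) Bochner_Integration.integrable_diff A A') linarith+
    from weak_solution_stability[OF \<Omega> bounds(1,3) ac ac' u u'] 1 2
    have "?m\<^sup>2 * (H1_norm \<Omega> (\<lambda>x. u x - u' x))\<^sup>2 < \<epsilon> + \<epsilon>"
      by linarith
    also have "\<epsilon> + \<epsilon> = ?m\<^sup>2 * e\<^sup>2" by (simp add: \<epsilon>_def)
    finally have "(H1_norm \<Omega> (\<lambda>x. u x - u' x))\<^sup>2 < e\<^sup>2"
      unfolding mult_less_cancel_left_pos[OF zero_less_power[OF m]] .
    then show ?thesis by (rule power2_less_imp_less) (use e in simp)
  qed
  moreover have "min \<delta>1 \<delta>2 > 0" using \<delta>1 \<delta>2 by simp
  ultimately show ?thesis by blast
qed

lemma trace_operator_diff_bound: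
  assumes \<gamma>: "trace_operator \<Omega> \<gamma>" and \<Omega>: "open \<Omega>"
  shows "\<exists>C>0. \<forall>u\<in>H1 \<Omega>. \<forall>v\<in>H1 \<Omega>.
    Hhalf_norm (frontier \<Omega>) (\<lambda>x. \<gamma> u x - \<gamma> v x) \<le> C * H1_norm \<Omega> (\<lambda>x. u x - v x)"
proof -
  obtain C where C: "\<And>u. u \<in> H1 \<Omega> \<Longrightarrow> Hhalf_norm (frontier \<Omega>) (\<gamma> u) \<le> C * H1_norm \<Omega> u"
    using \<gamma> unfolding trace_operator_def by blast
  have meas: "\<gamma> u \<in> borel_measurable (surface_measure (frontier \<Omega>))" if "u \<in> H1 \<Omega>" for u
  proof -
    have "\<gamma> u \<in> Hhalf (frontier \<Omega>)"
      using \<gamma> that unfolding trace_operator_def by blast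
    then show ?thesis by (simp add: Wfrac_def Lp_def)
  qed
  \<comment> \<open>The constant taken from \<open>trace_operator\<close> may fail to be positive;
    \<open>\<bar>C\<bar> + 1\<close> can later be divided by.\<close>
  have "Hhalf_norm (frontier \<Omega>) (\<lambda>x. \<gamma> u x - \<gamma> v x) \<le> (\<bar>C\<bar> + 1) * H1_norm \<Omega> (\<lambda>x. u x - v x)"
    if uv: "u \<in> H1 \<Omega>" "v \<in> H1 \<Omega>" for u v
  proof -
    note w = H1_diff(1)[OF \<Omega> uv]
    \<comment> \<open>The difference is written with coefficients 1 and -1 to match the linearity
      clause of \<open>trace_operator\<close>.\<close>
    have "AE x in surface_measure (frontier \<Omega>). \<gamma> (\<lambda>y. 1 * u y + (- 1) * v y) x = 1 * \<gamma> u x + (- 1) * \<gamma> v x"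
      using \<gamma> uv unfolding trace_operator_def by blast
    then have "AE x in surface_measure (frontier \<Omega>). \<gamma> u x - \<gamma> v x = \<gamma> (\<lambda>y. u y - v y) x"
      by (rule eventually_mono) simp
    then have "Hhalf_norm (frontier \<Omega>) (\<lambda>x. \<gamma> u x - \<gamma> v x) = Hhalf_norm (frontier \<Omega>) (\<gamma> (\<lambda>y. u y - v y))"
      by (rule Wfrac_norm_cong_AE[OF borel_measurable_diff[OF meas[OF uv(1)] meas[OF uv(2)]] meas[OF w]])
    also have "\<dots> \<le> C * H1_norm \<Omega> (\<lambda>x. u x - v x)" by (rule C[OF w])
    also have "\<dots> \<le> (\<bar>C\<bar> + 1) * H1_norm \<Omega> (\<lambda>x. u x - v x)"
      by (intro mult_right_mono H1_norm_nonneg) simp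
    finally show ?thesis .
  qed
  then show ?thesis by (intro exI[of _ "\<bar>C\<bar> + 1"] conjI ballI) simp_all
qed

theorem theorem3:
  fixes \<Omega> :: "'a::euclidean_space set"
    and \<gamma> :: "('a \<Rightarrow> real) \<Rightarrow> ('a \<Rightarrow> real)"
    and al au cl cu pM p q :: real
    and g :: "('a \<Rightarrow> real) \<Rightarrow> real"
    and G :: "('a \<Rightarrow> real) \<times> ('a \<Rightarrow> real) \<Rightarrow> ('a \<Rightarrow> real)"
  assumes dim: "DIM('a) \<in> {2, 3, 4}"
    and domain: "open \<Omega>" "bounded \<Omega>" "connected \<Omega>" "lipschitz_boundary \<Omega>"
    and bounds: "0 < al" "al \<le> au" "0 < cl" "cl \<le> cu"
    and trace: "trace_operator \<Omega> \<gamma>"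
    and pM: "2 < pM"
      "\<And>a c r h u. \<lbrakk>(a, c) \<in> admissible \<Omega> al au cl cu; 2 < r; r < pM;
          h \<in> Wfrac_dual (1 - 1 / (r / (r - 1))) (r / (r - 1)) (frontier \<Omega>);
          weak_solution \<Omega> \<gamma> a c h u\<rbrakk> \<Longrightarrow> u \<in> W1 r \<Omega>"
    and p: "2 < p" "p < pM"
    and q: "q = p / (p - 1)"
    and g: "g \<in> Wfrac_dual (1 - 1 / q) q (frontier \<Omega>)"
    and G: "\<And>a c. (a, c) \<in> admissible \<Omega> al au cl cu \<Longrightarrow> weak_solution \<Omega> \<gamma> a c g (G (a, c))"
  shows "continuous_map (admissible_topology \<Omega> al au cl cu) (H1_topology \<Omega>) G \<and>
         continuous_map (admissible_topology \<Omega> al au cl cu) (Hhalf_topology (frontier \<Omega>))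
           (\<lambda>(a, c). \<gamma> (G (a, c)))"
proof -
  have mem: "G z \<in> H1 \<Omega>" if "z \<in> admissible \<Omega> al au cl cu" for z
    using G that by (cases z) (auto simp: weak_solution_def)
  have cont: "\<exists>\<delta>>0. \<forall>z'\<in>admissible \<Omega> al au cl cu.
      (\<lambda>(a, c) (a', c'). L1_norm \<Omega> (\<lambda>x. a x - a' x) + L1_norm \<Omega> (\<lambda>x. c x - c' x)) z z' < \<delta> \<longrightarrow>
      H1_norm \<Omega> (\<lambda>x. G z x - G z' x) < e"
    if "z \<in> admissible \<Omega> al au cl cu" "0 < e" for z e
  proof -
    obtain a c where z: "z = (a, c)" by (cases z)
    then have ac: "(a, c) \<in> admissible \<Omega> al au cl cu" using that(1) by simp
    show ?thesis
      using parameter_to_solution_continuous_at[OF domain(1) bounds ac G[OF ac] that(2)] G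
      unfolding z by fast
  qed
  obtain C where C: "0 < C" "\<forall>u\<in>H1 \<Omega>. \<forall>v\<in>H1 \<Omega>.
      Hhalf_norm (frontier \<Omega>) (\<lambda>x. \<gamma> u x - \<gamma> v x) \<le> C * H1_norm \<Omega> (\<lambda>x. u x - v x)"
    using trace_operator_diff_bound[OF trace domain(1)] by blast
  have "continuous_map (admissible_topology \<Omega> al au cl cu) (H1_topology \<Omega>) G"
    unfolding admissible_topology_def H1_topology_def
    by (rule continuous_map_pseudometric_topology) (erule mem, erule (1) cont)
  moreover have "continuous_map (admissible_topology \<Omega> al au cl cu) (Hhalf_topology (frontier \<Omega>)) (\<lambda>z. \<gamma> (G z))"
    unfolding admissible_topology_def Hhalf_topology_def
  proof (rule continuous_map_pseudometric_topology)
    show "\<gamma> (G z) \<in> Hhalf (frontier \<Omega>)" if "z \<in> admissible \<Omega> al au cl cu" for z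
      using trace mem[OF that] unfolding trace_operator_def by blast
    fix z and e :: real assume z: "z \<in> admissible \<Omega> al au cl cu" and e: "0 < e"
    \<comment> \<open>The trace is Lipschitz with constant C, so closeness of the solutions within e
      / C suffices.\<close>
    have "Hhalf_norm (frontier \<Omega>) (\<lambda>x. \<gamma> (G z) x - \<gamma> (G z') x) < e"
      if "z' \<in> admissible \<Omega> al au cl cu" "H1_norm \<Omega> (\<lambda>x. G z x - G z' x) < e / C" for z'
      using C(2)[rule_format, OF mem[OF z] mem[OF that(1)]] that(2) C(1) by (simp add: pos_less_divide_eq mult.commute)
    with cont[OF z, of "e / C"] C(1) e
    show "\<exists>\<delta>>0. \<forall>z'\<in>admissible \<Omega> al au cl cu.
      (\<lambda>(a, c) (a', c'). L1_norm \<Omega> (\<lambda>x. a x - a' x) + L1_norm \<Omega> (\<lambda>x. c x - c' x)) z z' < \<delta> \<longrightarrow>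
      Hhalf_norm (frontier \<Omega>) (\<lambda>x. \<gamma> (G z) x - \<gamma> (G z') x) < e"
      by (meson divide_pos_pos)
  qed
  moreover have "(\<lambda>(a, c). \<gamma> (G (a, c))) = (\<lambda>z. \<gamma> (G z))" by auto
  ultimately show ?thesis by simp
qed

end
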